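(* Let $\{t_n\}_{n=0}^\infty\subset[0,1]$. The following two statements are equivalent: (i) $\{t_n\}$ satisfies condition (T): for every sequence $\{a_\nu\}_{\nu\ge 1}\in\ell_2$ with $a_\nu\ge 0$ for all $\nu$, $$\liminf_{m\to\infty}\frac{a_m}{t_m}\sum_{\nu=1}^m a_\nu=0.$$ (ii) For every real Hilbert space $H$, every family $\{C_\alpha\}_{\alpha\in\Omega}$ ($|\Omega|\ge 2$) of closed convex subsets of $H$ which is uniformly quasi-symmetric with respect to some point $a\in C=\bigcap_{\alpha\in\Omega}C_\alpha$, and every starting element $x_0\in H$, every sequence $\{x_n\}$ of remote projections onto $\{C_\alpha\}$ with weakness parameters $\{t_n\}$ starting at $x_0$ converges in norm to a point of $C$.
   Context: $H$ denotes a real Hilbert space with inner product $\langle\cdot,\cdot\rangle$ and norm $|\cdot|$; $P_\alpha$ denotes the metric (nearest point) projection onto the closed convex set $C_\alpha$, and $B(0,r)$ the closed ball of radius $r$ centered at $0$. Remote projections: given a family $\{C_\alpha\}_{\alpha\in\Omega}$ of closed convex sets with nonempty intersection, weakness parameters $t_n\in[0,1]$ and $x_0\in H$, a sequence of remote projections is defined by $x_{n+1}=P_{\alpha(n)}x_n$ ($n=0,1,2,\dots$), where $\alpha(n)\in\Omega$ is any index with $\mathrm{dist}(x_n,C_{\alpha(n)})\ge t_n\sup_{\alpha\in\Omega}\mathrm{dist}(x_n,C_\alpha)$; if $t_n=1$ for at least one $n$, it is additionally required that $\max_\alpha\mathrm{dist}(x,C_\alpha)$ is attained for every $x\in H$.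 A family $\{C_\alpha\}$ of closed convex sets all containing $0$ is uniformly quasi-symmetric if for every $r>0$ there is $\theta=\theta(r)\in(0,1]$ such that for all $\alpha$, $x\in C_\alpha\cap B(0,r)$ implies $-\theta x\in C_\alpha$. The family is uniformly quasi-symmetric with respect to a point $a\in\bigcap_\alpha C_\alpha$ if the family $\{C_\alpha-a\}$ is uniformly quasi-symmetric. *)

theory Defs
  imports "HOL-Analysis.Analysis"
begin

text \<open>Metric (nearest point) projection onto a set C (well defined for nonempty
  closed convex subsets of a real Hilbert space).\<close>
definition metric_proj :: "'a::real_inner set \<Rightarrow> 'a \<Rightarrow> 'a" where
  "metric_proj C x = (THE y. y \<in> C \<and> (\<forall>z\<in>C. norm (x - y) \<le> norm (x - z)))"

text \<open>Condition (T) on the weakness sequence; sequences are indexed from 1, and the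
  quotient a_m / t_m is taken in the extended reals (a/0 = infinity for a > 0, 0/0 = 0).\<close>
definition condition_T :: "(nat \<Rightarrow> real) \<Rightarrow> bool" where
  "condition_T t \<longleftrightarrow>
     (\<forall>a :: nat \<Rightarrow> real. (\<forall>\<nu>\<ge>1. 0 \<le> a \<nu>) \<and> summable (\<lambda>\<nu>. (a \<nu>)\<^sup>2) \<longrightarrow>
        liminf (\<lambda>m. ereal (a m) / ereal (t m) * ereal (\<Sum>\<nu>=1..m. a \<nu>)) = 0)"

definition unif_quasi_symmetric :: "'i set \<Rightarrow> ('i \<Rightarrow> 'a::real_normed_vector set) \<Rightarrow> bool" where
  "unif_quasi_symmetric \<Omega> C \<longleftrightarrow>
     (\<forall>\<alpha>\<in>\<Omega>. 0 \<in> C \<alpha>) \<and>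
     (\<forall>r>0. \<exists>\<theta>. 0 < \<theta> \<and> \<theta> \<le> 1 \<and>
        (\<forall>\<alpha>\<in>\<Omega>. \<forall>x. x \<in> C \<alpha> \<and> norm x \<le> r \<longrightarrow> - (\<theta> *\<^sub>R x) \<in> C \<alpha>))"

definition unif_quasi_symmetric_wrt ::
    "'i set \<Rightarrow> ('i \<Rightarrow> 'a::real_normed_vector set) \<Rightarrow> 'a \<Rightarrow> bool" where
  "unif_quasi_symmetric_wrt \<Omega> C a \<longleftrightarrow>
     a \<in> (\<Inter>\<alpha>\<in>\<Omega>. C \<alpha>) \<and> unif_quasi_symmetric \<Omega> (\<lambda>\<alpha>. (\<lambda>y. y - a) ` C \<alpha>)"

definition remote_projections ::
    "'i set \<Rightarrow> ('i \<Rightarrow> 'a::real_inner set) \<Rightarrow> (nat \<Rightarrow> real) \<Rightarrow> 'a \<Rightarrow> (nat \<Rightarrow> 'a) \<Rightarrow> bool" where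
  "remote_projections \<Omega> C t x0 x \<longleftrightarrow>
     x 0 = x0 \<and>
     ((\<exists>n. t n = 1) \<longrightarrow>
        (\<forall>y. \<exists>\<alpha>\<in>\<Omega>. infdist y (C \<alpha>) = (SUP \<beta>\<in>\<Omega>. infdist y (C \<beta>)))) \<and>
     (\<forall>n. \<exists>\<alpha>\<in>\<Omega>. infdist (x n) (C \<alpha>) \<ge> t n * (SUP \<beta>\<in>\<Omega>. infdist (x n) (C \<beta>)) \<and>
                  x (Suc n) = metric_proj (C \<alpha>) (x n))"

text \<open>Statement (ii) restricted to a given space type 'a and index type 'i.\<close>
definition remote_projections_converge ::
    "(nat \<Rightarrow> real) \<Rightarrow> 'a::{real_inner,complete_space} itself \<Rightarrow> 'i itself \<Rightarrow> bool" where
  "remote_projections_converge t _ _ \<longleftrightarrow>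
     (\<forall>(\<Omega>::'i set) (C::'i \<Rightarrow> 'a set) a x0 x.
        (\<exists>\<alpha>\<in>\<Omega>. \<exists>\<beta>\<in>\<Omega>. \<alpha> \<noteq> \<beta>) \<and>
        (\<forall>\<alpha>\<in>\<Omega>. closed (C \<alpha>) \<and> convex (C \<alpha>)) \<and>
        unif_quasi_symmetric_wrt \<Omega> C a \<and>
        remote_projections \<Omega> C t x0 x
        \<longrightarrow> (\<exists>z \<in> (\<Inter>\<alpha>\<in>\<Omega>. C \<alpha>). x \<longlonglongrightarrow> z))"

definition infinite_dimensional :: "'a::real_vector itself \<Rightarrow> bool" where
  "infinite_dimensional _ \<longleftrightarrow> \<not> (\<exists>B::'a set. finite B \<and> span B = UNIV)"

end

theory Submission
  imports Defs
begin

text \<open>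
  Sufficiency. Put \<open>d\<^sub>k = |x\<^sub>k - x\<^sub>k\<^sub>+\<^sub>1|\<close>; the distances to a point of the intersection decrease and
  \<open>d\<close> is square summable. Quasi-symmetry turns the variational inequality of the projections into
  \<open>|x\<^sub>n - x\<^sub>m|\<^sup>2 \<le> (1 + 1/\<theta>) (|x\<^sub>n - a|\<^sup>2 - |x\<^sub>m - a|\<^sup>2) + 2 (d\<^sub>m/t\<^sub>m) (d\<^sub>n + \<dots> + d\<^sub>m)\<close>
  and condition (T), applied to \<open>d\<^sub>k + 2\<^sup>-\<^sup>k\<close>, makes the last term small for infinitely many \<open>m\<close>. The
  summand \<open>2\<^sup>-\<^sup>k\<close> excludes the indices with \<open>d\<^sub>m = t\<^sub>m = 0\<close> and forces \<open>d\<^sub>m/t\<^sub>m\<close> itself to be small.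

  Necessity. If (T) fails, there is a positive \<open>b \<in> \<ell>\<^sub>2\<close> with divergent partial sums \<open>\<sigma>\<^sub>n\<close> and
  \<open>b\<^sub>n \<sigma>\<^sub>n \<ge> 24 t\<^sub>n\<close> for large \<open>n\<close>. Project onto hyperplanes orthogonal to unit vectors
  \<open>A e\<^sub>p - B e\<^sub>L\<close> with \<open>A, B \<ge> 0\<close>, so that the largest coordinate \<open>M\<^sub>n\<close> of \<open>x\<^sub>n \<ge> 0\<close> is gradually split
  into two. A step of size about \<open>b\<^sub>n\<close> costs \<open>O(b\<^sub>n\<^sup>2)\<close> of the squared norm and increases the \<open>\<ell>\<^sub>1\<close>-norm
  \<open>S\<^sub>n\<close> of the coordinates by about \<open>b\<^sub>n\<close>. As the coordinates stay comparable, \<open>M\<^sub>n S\<^sub>n\<close> is bounded,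
  hence \<open>M\<^sub>n = O(1/\<sigma>\<^sub>n)\<close> and the step \<open>b\<^sub>n\<close> exceeds \<open>t\<^sub>n M\<^sub>n\<close>, while \<open>M\<^sub>n\<close> bounds all distances because
  of the opposite signs of \<open>A\<close> and \<open>-B\<close>. When \<open>b\<^sub>n\<close> is not small against \<open>M\<^sub>n\<close>, the largest coordinate is
  simply deleted. The norm of \<open>x\<^sub>n\<close> stays away from zero, although only \<open>0\<close> could be a limit in
  the intersection.
\<close>

section \<open>Metric projections\<close>

text \<open>A minimizing sequence is Cauchy by the parallelogram law, because midpoints stay in the
  convex set; completeness takes the place of compactness.\<close>

lemma nearest_point_exists:
  fixes C :: "'a::{real_inner,complete_space} set"
  assumes "closed C" "convex C" "C \<noteq> {}"
  shows "\<exists>y\<in>C. \<forall>z\<in>C. norm (x - y) \<le> norm (x - z)"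
proof -
  define d where "d = infdist x C"
  have d0: "0 \<le> d" unfolding d_def by (rule infdist_nonneg)
  have dle: "d\<^sup>2 \<le> (norm (x - z))\<^sup>2" if "z \<in> C" for z
    using infdist_le[OF that, of x] d0 unfolding d_def dist_norm by (rule power_mono)
  have "\<exists>y\<in>C. (norm (x - y))\<^sup>2 < d\<^sup>2 + 1 / real (Suc n)" for n
  proof -
    define e where "e = sqrt (d\<^sup>2 + 1 / real (Suc n))"
    have "d < e" unfolding e_def by (rule real_less_rsqrt) simp
    have "\<exists>y\<in>C. dist x y < e"
    proof (rule ccontr)
      assume "\<not> ?thesis"
      then have "e \<le> d"
        unfolding d_def infdist_notempty[OF assms(3)] by (intro cINF_greatest[OF assms(3)]) (simp add: not_less)
      with \<open>d < e\<close> show False by simp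
    qed
    then obtain y where "y \<in> C" "dist x y < e" by blast
    moreover have "e\<^sup>2 = d\<^sup>2 + 1 / real (Suc n)" unfolding e_def by (simp add: add_nonneg_nonneg)
    ultimately show ?thesis
      by (metis dist_norm norm_ge_zero power_strict_mono zero_less_numeral)
  qed
  then obtain y where yC: "\<And>n. y n \<in> C" and y: "\<And>n. (norm (x - y n))\<^sup>2 < d\<^sup>2 + 1 / real (Suc n)"
    by metis
  have diff: "(norm (y m - y n))\<^sup>2 \<le> 2 / real (Suc m) + 2 / real (Suc n)" for m n
  proof -
    have mid: "(1/2) *\<^sub>R y m + (1/2) *\<^sub>R y n \<in> C"
      using convexD[OF assms(2) yC yC, of "1/2" "1/2"] by simp
    have "(norm (y m - y n))\<^sup>2 = 2 * (norm (x - y m))\<^sup>2 + 2 * (norm (x - y n))\<^sup>2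
        - 4 * (norm (x - ((1/2) *\<^sub>R y m + (1/2) *\<^sub>R y n)))\<^sup>2"
      unfolding power2_norm_eq_inner by (simp add: inner_simps inner_commute algebra_simps)
    also have "\<dots> \<le> 2 / real (Suc m) + 2 / real (Suc n)"
      using dle[OF mid] y[of m] y[of n] by simp
    finally show ?thesis .
  qed
  have "Cauchy y"
  proof (rule metric_CauchyI)
    fix e :: real assume e: "e > 0"
    obtain N where N: "4 / e\<^sup>2 < real N" using reals_Archimedean2 by blast
    show "\<exists>M. \<forall>m\<ge>M. \<forall>n\<ge>M. dist (y m) (y n) < e"
    proof (intro exI allI impI)
      fix m n assume mn: "N \<le> m" "N \<le> n"
      have "2 / real (Suc k) < e\<^sup>2 / 2" if "N \<le> k" for k
      proof -
        have "4 / e\<^sup>2 < real (Suc k)" using N that by linarith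
        then show ?thesis using e by (simp add: field_simps)
      qed
      from this[OF mn(1)] this[OF mn(2)] have "(norm (y m - y n))\<^sup>2 < e\<^sup>2"
        using diff[of m n] by linarith
      then show "dist (y m) (y n) < e"
        using e power2_less_imp_less[of "norm (y m - y n)" e] by (simp add: dist_norm)
    qed
  qed
  then obtain l where l: "y \<longlonglongrightarrow> l" using Cauchy_convergent convergent_def by blast
  have lC: "l \<in> C" using closed_sequentially[OF assms(1)] yC l by blast
  have "(\<lambda>n. (norm (x - y n))\<^sup>2) \<longlonglongrightarrow> (norm (x - l))\<^sup>2" by (intro tendsto_intros l)
  moreover have "(\<lambda>n. d\<^sup>2 + 1 / real (Suc n)) \<longlonglongrightarrow> d\<^sup>2 + 0"
    by (intro tendsto_add tendsto_const LIMSEQ_Suc lim_1_over_n)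
  ultimately have "(norm (x - l))\<^sup>2 \<le> d\<^sup>2 + 0"
    using y less_imp_le by (intro LIMSEQ_le) auto
  then have "norm (x - l) \<le> norm (x - z)" if "z \<in> C" for z
    using dle[OF that] by (intro power2_le_imp_le[OF _ norm_ge_zero]) linarith
  then show ?thesis using lC by blast
qed

text \<open>Evaluates the definite description; uniqueness of the nearest point comes from
  convexity.\<close>

lemma metric_proj_eqI:
  fixes C :: "'a::real_inner set"
  assumes "closed C" "convex C" "y \<in> C" "\<And>z. z \<in> C \<Longrightarrow> norm (x - y) \<le> norm (x - z)"
  shows "metric_proj C x = y"
  unfolding metric_proj_def
  using assms by (intro the_equality) (auto intro!: any_closest_point_unique[OF assms(2,1), of _ _ x] simp: dist_norm)

lemma
  fixes C :: "'a::{real_inner,complete_space} set"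
  assumes "closed C" "convex C" "C \<noteq> {}"
  shows metric_proj_in: "metric_proj C x \<in> C"
    and infdist_metric_proj: "infdist x C = norm (x - metric_proj C x)"
    and metric_proj_inner: "z \<in> C \<Longrightarrow> (x - metric_proj C x) \<bullet> (z - metric_proj C x) \<le> 0"
proof -
  obtain y where y: "y \<in> C" "\<And>z. z \<in> C \<Longrightarrow> norm (x - y) \<le> norm (x - z)"
    using nearest_point_exists[OF assms] by blast
  have eq: "metric_proj C x = y" by (rule metric_proj_eqI[OF assms(1,2) y])
  show "metric_proj C x \<in> C" using eq y by simp
  show "infdist x C = norm (x - metric_proj C x)"
    unfolding eq infdist_notempty[OF assms(3)]
    by (rule cInf_eq_minimum) (use y in \<open>auto simp: dist_norm\<close>)
  show "(x - metric_proj C x) \<bullet> (z - metric_proj C x) \<le> 0" if "z \<in> C"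
    unfolding eq using any_closest_point_dot[OF assms(2,1) y(1) that] y by (simp add: dist_norm)
qed

text \<open>The angle at the projection is not acute. This yields both the decreasing distances to a
  common point and the square summable step lengths.\<close>

lemma metric_proj_pythagoras:
  fixes C :: "'a::{real_inner,complete_space} set"
  assumes "closed C" "convex C" "z \<in> C"
  shows "(norm (metric_proj C x - z))\<^sup>2 + (norm (x - metric_proj C x))\<^sup>2 \<le> (norm (x - z))\<^sup>2"
proof -
  have "(x - metric_proj C x) \<bullet> (z - metric_proj C x) \<le> 0"
    using assms by (intro metric_proj_inner) auto
  moreover have "(norm (x - z))\<^sup>2 = (norm (metric_proj C x - z))\<^sup>2 + (norm (x - metric_proj C x))\<^sup>2
      - 2 * ((x - metric_proj C x) \<bullet> (z - metric_proj C x))"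
    unfolding power2_norm_eq_inner by (simp add: inner_simps inner_commute algebra_simps)
  ultimately show ?thesis by linarith
qed

text \<open>Testing the variational inequality for the projection of \<open>u\<close> at the point
  \<open>a - \<theta> (P v - a)\<close> of \<open>C\<close> is what replaces the identity \<open>(u - P u) \<bullet> (P v - a) = 0\<close>
  available for subspaces.\<close>
lemma metric_proj_quasi_symmetric:
  fixes C :: "'a::{real_inner,complete_space} set"
  assumes "closed C" "convex C" "a \<in> C" "0 < \<theta>"
    and sym: "\<And>y. y \<in> C \<Longrightarrow> norm (y - a) \<le> r \<Longrightarrow> a - \<theta> *\<^sub>R (y - a) \<in> C"
    and v: "norm (v - a) \<le> r" "infdist v C \<le> \<delta>"
  shows "- ((norm (u - a))\<^sup>2 - (norm (metric_proj C u - a))\<^sup>2) / (2 * \<theta>) - norm (u - metric_proj C u) * \<delta>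
    \<le> (u - metric_proj C u) \<bullet> (v - a)"
proof -
  have ne: "C \<noteq> {}" using assms(3) by auto
  define p where "p = metric_proj C u"
  define y where "y = metric_proj C v"
  have yC: "y \<in> C" unfolding y_def by (rule metric_proj_in[OF assms(1,2) ne])
  have "(norm (y - a))\<^sup>2 \<le> (norm (v - a))\<^sup>2"
    using metric_proj_pythagoras[OF assms(1-3), of v] unfolding y_def
    by (smt (verit) zero_le_power2)
  then have "norm (y - a) \<le> r" using v(1) power2_le_imp_le by fastforce
  then have w: "a - \<theta> *\<^sub>R (y - a) \<in> C" by (rule sym[OF yC])
  have "(u - p) \<bullet> (a - \<theta> *\<^sub>R (y - a) - p) \<le> 0"
    unfolding p_def by (rule metric_proj_inner[OF assms(1,2) ne w])
  moreover have "(u - p) \<bullet> (a - \<theta> *\<^sub>R (y - a) - p)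
      = - (\<theta> * ((u - p) \<bullet> (y - a))) - (u - p) \<bullet> (p - a)"
    by (simp add: inner_simps algebra_simps)
  moreover have "(norm (u - a))\<^sup>2 = (norm (u - p))\<^sup>2 + (norm (p - a))\<^sup>2 + 2 * ((u - p) \<bullet> (p - a))"
    unfolding power2_norm_eq_inner by (simp add: inner_simps inner_commute algebra_simps)
  \<comment> \<open>The term |u - p|^2 has the favourable sign and is dropped.\<close>
  ultimately have "- ((norm (u - a))\<^sup>2 - (norm (p - a))\<^sup>2) \<le> 2 * (\<theta> * ((u - p) \<bullet> (y - a)))"
    using zero_le_power2[of "norm (u - p)"] by linarith
  then have 1: "- ((norm (u - a))\<^sup>2 - (norm (p - a))\<^sup>2) / (2 * \<theta>) \<le> (u - p) \<bullet> (y - a)"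
    using assms(4) by (simp add: divide_le_eq mult_ac)
  \<comment> \<open>Passing from \<open>y\<close> back to \<open>v\<close> costs at most |u - p| |v
    - y|, and |v - y| is the distance of \<open>v\<close> from \<open>C\<close>.\<close>
  have "norm (v - y) \<le> \<delta>"
    using v(2) infdist_metric_proj[OF assms(1,2) ne, of v] by (simp add: y_def)
  then have "norm (u - p) * norm (v - y) \<le> norm (u - p) * \<delta>"
    by (intro mult_left_mono) auto
  then have "- (norm (u - p) * \<delta>) \<le> (u - p) \<bullet> (v - y)"
    using Cauchy_Schwarz_ineq2[of "u - p" "v - y"] by linarith
  moreover have "(u - p) \<bullet> (v - a) = (u - p) \<bullet> (y - a) + (u - p) \<bullet> (v - y)"
    by (simp add: inner_simps algebra_simps)
  ultimately show ?thesis using 1 unfolding p_def by linarith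
qed

section \<open>Condition (T) implies convergence\<close>

text \<open>Positivity of \<open>e\<close> makes the quotient infinite wherever
  \<open>t m = 0\<close>, so the late indices with a small value have \<open>t m > 0\<close> and the
  value is an ordinary real.\<close>

lemma condition_T_obtain_small:
  assumes t: "\<And>n. 0 \<le> t n" and T: "condition_T t"
    and e: "\<And>n. 0 < e n" "summable (\<lambda>n. (e n)\<^sup>2)" and \<epsilon>: "0 < \<epsilon>"
  obtains m where "N \<le> m" "0 < t m" "e m / t m * (\<Sum>\<nu>=1..m. e \<nu>) < \<epsilon>"
proof -
  let ?f = "\<lambda>m. ereal (e m) / ereal (t m) * ereal (\<Sum>\<nu>=1..m. e \<nu>)"
  have L: "liminf ?f = 0"
    using T e less_imp_le unfolding condition_T_def by blast
  \<comment> \<open>\<open>Suc N\<close> keeps m positive, so that the sum from 1 to m is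
    nonempty.\<close>
  have "\<exists>m\<ge>Suc N. ?f m < ereal \<epsilon>"
  proof (rule ccontr)
    assume "\<not> ?thesis"
    then have "\<forall>\<^sub>F m in sequentially. ereal \<epsilon> \<le> ?f m"
      unfolding eventually_sequentially by (meson not_le)
    then have "ereal \<epsilon> \<le> liminf ?f" by (rule Liminf_bounded)
    then show False using L \<epsilon> by simp
  qed
  then obtain m where m: "Suc N \<le> m" "?f m < ereal \<epsilon>" by blast
  have pos: "0 < (\<Sum>\<nu>=1..m. e \<nu>)" using e(1) m(1) by (intro sum_pos) auto
  have "t m \<noteq> 0"
  proof
    assume "t m = 0"
    then have "?f m = \<infinity>" using e(1)[of m] pos by (simp add: divide_ereal_def zero_ereal_def[symmetric])
    with m(2) show False by (simp only:) simp
  qed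
  then have "0 < t m" using t[of m] by linarith
  moreover have "?f m = ereal (e m / t m * (\<Sum>\<nu>=1..m. e \<nu>))" using \<open>t m \<noteq> 0\<close> by simp
  then have "e m / t m * (\<Sum>\<nu>=1..m. e \<nu>) < \<epsilon>" using m(2) by simp
  ultimately show ?thesis using that[of m] m(1) by simp
qed

theorem condition_T_imp_convergence:
  fixes C :: "'i \<Rightarrow> 'a::{real_inner,complete_space} set"
  assumes t: "\<And>n. 0 \<le> t n" and T: "condition_T t"
    and C: "\<And>\<alpha>. \<alpha> \<in> \<Omega> \<Longrightarrow> closed (C \<alpha>)" "\<And>\<alpha>. \<alpha> \<in> \<Omega> \<Longrightarrow> convex (C \<alpha>)"
    and sym: "unif_quasi_symmetric_wrt \<Omega> C a"
    and x: "remote_projections \<Omega> C t x0 x"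
  shows "\<exists>z \<in> (\<Inter>\<alpha>\<in>\<Omega>. C \<alpha>). x \<longlonglongrightarrow> z"
proof -
  have aC: "a \<in> C \<alpha>" if "\<alpha> \<in> \<Omega>" for \<alpha>
    using sym that unfolding unif_quasi_symmetric_wrt_def by blast
  obtain \<alpha> where \<alpha>: "\<And>n. \<alpha> n \<in> \<Omega>"
    and far: "\<And>n. t n * (SUP \<beta>\<in>\<Omega>. infdist (x n) (C \<beta>)) \<le> infdist (x n) (C (\<alpha> n))"
    and step: "\<And>n. x (Suc n) = metric_proj (C (\<alpha> n)) (x n)"
    using x unfolding remote_projections_def by metis
  define d where "d n = norm (x n - x (Suc n))" for n
  define G where "G n = (norm (x n - a))\<^sup>2" for n
  \<comment> \<open>The added 1 keeps the radius positive even if the start is \<open>a\<close>, as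
    quasi-symmetry requires.\<close>
  define r where "r = norm (x 0 - a) + 1"
  have "r > 0" unfolding r_def by (smt (verit) norm_ge_zero)
  then obtain \<theta> where \<theta>: "0 < \<theta>"
    and "\<forall>\<alpha>\<in>\<Omega>. \<forall>y. y \<in> (\<lambda>y. y - a) ` C \<alpha> \<and> norm y \<le> r \<longrightarrow> - (\<theta> *\<^sub>R y) \<in> (\<lambda>y. y - a) ` C \<alpha>"
    using sym unfolding unif_quasi_symmetric_wrt_def unif_quasi_symmetric_def by blast
  then have \<theta>sym: "a - \<theta> *\<^sub>R (y - a) \<in> C \<beta>" if "\<beta> \<in> \<Omega>" "y \<in> C \<beta>" "norm (y - a) \<le> r" for y \<beta>
  proof -
    have "- (\<theta> *\<^sub>R (y - a)) \<in> (\<lambda>y. y - a) ` C \<beta>"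
      using that \<open>\<forall>\<alpha>\<in>\<Omega>. _\<close> by blast
    then obtain w where "w \<in> C \<beta>" "- (\<theta> *\<^sub>R (y - a)) = w - a" by blast
    then show ?thesis by (metis add.commute diff_add_cancel uminus_add_conv_diff)
  qed
  have Gdec: "G (Suc n) + (d n)\<^sup>2 \<le> G n" for n
    unfolding G_def d_def step using C \<alpha> aC by (intro metric_proj_pythagoras) auto
  have Gmono: "decseq G" unfolding decseq_Suc_iff using Gdec by (smt (verit) zero_le_power2)
  have xr: "norm (x n - a) \<le> r" for n
  proof -
    have "(norm (x n - a))\<^sup>2 \<le> (norm (x 0 - a))\<^sup>2"
      using decseqD[OF Gmono, of 0 n] unfolding G_def by simp
    then have "norm (x n - a) \<le> norm (x 0 - a)" by (rule power2_le_imp_le) simp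
    then show ?thesis unfolding r_def by simp
  qed
  have d2: "summable (\<lambda>n. (d n)\<^sup>2)"
  proof (rule summableI_nonneg_bounded)
    fix n
    have "(\<Sum>k<n. (d k)\<^sup>2) \<le> G 0 - G n"
    proof (induction n)
      case (Suc n) then show ?case using Gdec[of n] by simp
    qed simp
    then show "(\<Sum>k<n. (d k)\<^sup>2) \<le> G 0" unfolding G_def by (smt (verit) zero_le_power2)
  qed simp
  define e where "e n = d n + (1/2) ^ n" for n
  have epos: "0 < e n" for n unfolding e_def d_def by (simp add: add_nonneg_pos)
  have e2: "summable (\<lambda>n. (e n)\<^sup>2)"
  proof (rule summable_comparison_test)
    show "summable (\<lambda>n. 2 * (d n)\<^sup>2 + 2 * (1/4) ^ n)"
      by (intro summable_add summable_mult d2 summable_geometric) simp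
    have "(e n)\<^sup>2 \<le> 2 * (d n)\<^sup>2 + 2 * (1/4) ^ n" for n
    proof -
      have "(e n)\<^sup>2 \<le> 2 * (d n)\<^sup>2 + 2 * ((1/2) ^ n)\<^sup>2"
        unfolding e_def by (smt (verit) sum_squares_bound power2_sum)
      also have "((1/2) ^ n)\<^sup>2 = (1/4 :: real) ^ n" by (simp add: power2_eq_square flip: power_mult_distrib)
      finally show ?thesis .
    qed
    then show "\<exists>N. \<forall>n\<ge>N. norm ((e n)\<^sup>2) \<le> 2 * (d n)\<^sup>2 + 2 * (1/4) ^ n" by auto
  qed
  \<comment> \<open>Condition (T) supplies arbitrarily late m for which \<open>x m\<close> is close
    to every set and can be compared with all earlier iterates. The estimate starts at n = 1 because
    the sums in (T) do.\<close>
  have good: "\<exists>m\<ge>N. (\<forall>\<beta>\<in>\<Omega>. infdist (x m) (C \<beta>) < \<epsilon>) \<and>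
      (\<forall>n. 1 \<le> n \<longrightarrow> n \<le> m \<longrightarrow> (norm (x n - x m))\<^sup>2 \<le> (1 + 1 / \<theta>) * (G n - G m) + \<epsilon>)"
    if \<epsilon>: "0 < \<epsilon>" for \<epsilon> N
  proof -
    obtain m where m: "Suc N \<le> m" "0 < t m" "e m / t m * (\<Sum>\<nu>=1..m. e \<nu>) < \<epsilon> / 2"
      using condition_T_obtain_small[OF t T epos e2, of "\<epsilon> / 2" "Suc N"] \<epsilon> by auto
    define \<delta> where "\<delta> = e m / t m"
    have \<delta>: "0 < \<delta>" unfolding \<delta>_def using epos m(2) by simp
    have dist\<delta>: "infdist (x m) (C \<beta>) \<le> \<delta>" if \<beta>: "\<beta> \<in> \<Omega>" for \<beta>
    proof -
      have "bdd_above ((\<lambda>\<beta>. infdist (x m) (C \<beta>)) ` \<Omega>)"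
        using aC by (intro bdd_aboveI2[of _ _ "dist (x m) a"] infdist_le)
      then have "infdist (x m) (C \<beta>) \<le> (SUP \<beta>\<in>\<Omega>. infdist (x m) (C \<beta>))"
        using \<beta> by (rule cSUP_upper[rotated])
      then have "t m * infdist (x m) (C \<beta>) \<le> infdist (x m) (C (\<alpha> m))"
        using far[of m] m(2) by (smt (verit) mult_left_mono)
      also have "\<dots> = d m" 
        unfolding d_def step using C[OF \<alpha>] aC[OF \<alpha>, of m] by (intro infdist_metric_proj) auto
      also have "\<dots> \<le> e m" unfolding e_def by simp
      finally show ?thesis unfolding \<delta>_def using m(2) by (simp add: le_divide_eq mult.commute)
    qed
    \<comment> \<open>The summand (1/2)^1 keeps the sum above 1/2, so a small product forces
      \<delta> itself to be small.\<close>
    have "1/2 \<le> e 1" unfolding e_def d_def by simp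
    also have "\<dots> \<le> (\<Sum>\<nu>=1..m. e \<nu>)"
      using m(1) epos less_imp_le by (intro member_le_sum) auto
    finally have "\<delta> * (1/2) \<le> \<delta> * (\<Sum>\<nu>=1..m. e \<nu>)"
      using \<delta> by (intro mult_left_mono) auto
    then have "\<delta> < \<epsilon>" using m(3)[folded \<delta>_def] by linarith
    moreover have "(norm (x n - x m))\<^sup>2 \<le> (1 + 1 / \<theta>) * (G n - G m) + \<epsilon>" if n: "1 \<le> n" "n \<le> m" for n
    proof -
      \<comment> \<open>The one-step estimate is summed over k with the same v = \<open>x m\<close>,
        which lies within \<delta> of every set; the values of \<open>G\<close> and the steps both
        telescope.\<close>
      have "- (G n - G m) / (2 * \<theta>) - \<delta> * (\<Sum>k=n..<m. d k)
          = (\<Sum>k=n..<m. - (G k - G (Suc k)) / (2 * \<theta>) - d k * \<delta>)"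
        using sum_Suc_diff'[OF n(2), of G]
        by (simp add: sum_subtractf sum_negf sum_divide_distrib[symmetric] sum_distrib_left mult.commute)
      also have "\<dots> \<le> (\<Sum>k=n..<m. (x k - x (Suc k)) \<bullet> (x m - a))"
        unfolding G_def d_def step using C \<alpha> aC \<theta>sym xr dist\<delta> \<theta>
        by (intro sum_mono metric_proj_quasi_symmetric[where r = r]) auto
      also have "\<dots> = (x n - x m) \<bullet> (x m - a)"
        using sum_Suc_diff'[OF n(2), of "\<lambda>k. - x k"] by (simp add: inner_sum_left[symmetric])
      finally have 1: "- (G n - G m) / (2 * \<theta>) - \<delta> * (\<Sum>k=n..<m. d k) \<le> (x n - x m) \<bullet> (x m - a)" .
      have "(\<Sum>k=n..<m. d k) \<le> (\<Sum>\<nu>=1..m. e \<nu>)"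
      proof -
        have "(\<Sum>k=n..<m. d k) \<le> (\<Sum>k=n..<m. e k)" unfolding e_def by (intro sum_mono) simp
        also have "\<dots> \<le> (\<Sum>\<nu>=1..m. e \<nu>)"
          using n epos less_imp_le by (intro sum_mono2) auto
        finally show ?thesis .
      qed
      then have "\<delta> * (\<Sum>k=n..<m. d k) \<le> \<delta> * (\<Sum>\<nu>=1..m. e \<nu>)" using \<delta> by (intro mult_left_mono) auto
      then have 2: "\<delta> * (\<Sum>k=n..<m. d k) < \<epsilon> / 2" using m(3)[folded \<delta>_def] by linarith
      have "(norm (x n - x m))\<^sup>2 = G n - G m - 2 * ((x n - x m) \<bullet> (x m - a))"
        unfolding G_def power2_norm_eq_inner by (simp add: inner_simps inner_commute algebra_simps)
      also have "\<dots> \<le> G n - G m + 2 * ((G n - G m) / (2 * \<theta>)) + \<epsilon>"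
        using 1 2 unfolding minus_divide_left[symmetric] by linarith
      also have "\<dots> = (1 + 1 / \<theta>) * (G n - G m) + \<epsilon>" using \<theta> by (simp add: field_simps)
      finally show ?thesis .
    qed
    ultimately show ?thesis using m(1) dist\<delta> by (intro exI[of _ m]) fastforce
  qed
  have Gconv: "Cauchy G"
  proof -
    have "convergent G"
    proof (rule Bseq_monoseq_convergent)
      have "norm (G n) \<le> G 0" for n
        using decseqD[OF Gmono, of 0 n] unfolding G_def by simp
      then show "Bseq G" by (rule BseqI')
      show "monoseq G" using Gmono by (rule decseq_imp_monoseq)
    qed
    then show ?thesis by (rule convergent_Cauchy)
  qed
  have "Cauchy x"
  proof (rule metric_CauchyI)
    fix \<rho> :: real assume \<rho>: "\<rho> > 0"
    define K where "K = 1 + 1 / \<theta>"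
    have K: "K > 0" unfolding K_def using \<theta> by (simp add: add_pos_pos)
    \<comment> \<open>With K \<eta> = \<rho>^2/16 the squared distance to the common comparison
      point \<open>x m\<close> stays below \<rho>^2/8, hence below (\<rho>/2)^2.\<close>
    define \<eta> where "\<eta> = \<rho>\<^sup>2 / 16 / K"
    have \<eta>: "\<eta> > 0" unfolding \<eta>_def using \<rho> K by simp
    obtain N where N: "\<And>m n. N \<le> m \<Longrightarrow> N \<le> n \<Longrightarrow> dist (G m) (G n) < \<eta>"
      using metric_CauchyD[OF Gconv \<eta>] by blast
    show "\<exists>M. \<forall>m\<ge>M. \<forall>n\<ge>M. dist (x m) (x n) < \<rho>"
    proof (intro exI allI impI)
      fix n n' assume nn': "Suc N \<le> n" "Suc N \<le> n'"
      obtain m where m: "n + n' \<le> m"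
        and *: "\<And>n. 1 \<le> n \<Longrightarrow> n \<le> m \<Longrightarrow> (norm (x n - x m))\<^sup>2 \<le> K * (G n - G m) + \<rho>\<^sup>2 / 16"
        using good[of "\<rho>\<^sup>2 / 16" "n + n'"] \<rho> unfolding K_def by auto
      have "norm (x k - x m) < \<rho> / 2" if k: "Suc N \<le> k" "k \<le> m" for k
      proof -
        have "G k - G m < \<eta>" using N[of k m] k by (simp add: dist_real_def)
        then have "K * (G k - G m) < \<rho>\<^sup>2 / 16" using K unfolding \<eta>_def by (simp add: less_divide_eq mult_ac)
        moreover have "(norm (x k - x m))\<^sup>2 \<le> K * (G k - G m) + \<rho>\<^sup>2 / 16" using * k by simp
        moreover have "(\<rho> / 2)\<^sup>2 = \<rho>\<^sup>2 / 4" by (simp add: power_divide)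
        ultimately have "(norm (x k - x m))\<^sup>2 < (\<rho> / 2)\<^sup>2" using zero_less_power[OF \<rho>, of 2] by linarith
        then show ?thesis using \<rho> by (intro power2_less_imp_less[of _ "\<rho> / 2"]) auto
      qed
      from this[of n] this[of n'] show "dist (x n) (x n') < \<rho>"
        using nn' m dist_triangle_half_l[of "x n" "x m" \<rho> "x n'"] by (simp add: dist_norm norm_minus_commute)
    qed
  qed
  then obtain z where z: "x \<longlonglongrightarrow> z" using Cauchy_convergent convergent_def by blast
  \<comment> \<open>The distances to the sets are known to be small only at the good indices, but
    these occur arbitrarily late.\<close>
  have "z \<in> C \<beta>" if \<beta>: "\<beta> \<in> \<Omega>" for \<beta>
  proof -
    have "infdist z (C \<beta>) \<le> 0 + \<epsilon>" if \<epsilon>: "0 < \<epsilon>" for \<epsilon>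
    proof -
      obtain N where N: "\<And>n. N \<le> n \<Longrightarrow> dist (x n) z < \<epsilon> / 2"
        using metric_LIMSEQ_D[OF z, of "\<epsilon> / 2"] \<epsilon> by auto
      obtain m where "N \<le> m" "infdist (x m) (C \<beta>) < \<epsilon> / 2"
        using good[of "\<epsilon> / 2" N] \<epsilon> \<beta> by auto
      then show ?thesis using N[of m] infdist_triangle[of z "C \<beta>" "x m"] by (simp add: dist_commute)
    qed
    then have "infdist z (C \<beta>) = 0" using infdist_nonneg[of z "C \<beta>"] field_le_epsilon by (metis order_antisym)
    then show ?thesis using C(1)[OF \<beta>] aC[OF \<beta>] in_closed_iff_infdist_zero by (metis empty_iff)
  qed
  then show ?thesis using z by blast
qed

section \<open>Orthonormal sequences and hyperplanes\<close>

text \<open>Gram-Schmidt by dependent choice: finitely many vectors never span the space.\<close>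

lemma infinite_dimensional_orthonormal_sequence:
  assumes "infinite_dimensional TYPE('a::real_inner)"
  obtains e :: "nat \<Rightarrow> 'a::real_inner" where "\<And>i j. e i \<bullet> e j = (if i = j then 1 else 0)"
proof -
  have "\<exists>f :: nat \<Rightarrow> 'a. \<forall>n. norm (f n) = 1 \<and> (\<forall>k<n. f n \<bullet> f k = 0)"
  proof (rule dependent_wellorder_choice)
    fix n :: nat and f :: "nat \<Rightarrow> 'a"
    assume f: "\<And>m. m < n \<Longrightarrow> norm (f m) = 1 \<and> (\<forall>k<m. f m \<bullet> f k = 0)"
    have orth: "f k \<bullet> f j = (if k = j then 1 else 0)" if "k < n" "j < n" for k j
      using f[OF that(1)] f[OF that(2)]
      by (metis dot_square_norm inner_commute linorder_neqE_nat power_one)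
    have "span (f ` {..<n}) \<noteq> UNIV"
      using assms unfolding infinite_dimensional_def by (metis finite_imageI finite_lessThan)
    then obtain v where v: "v \<notin> span (f ` {..<n})" by blast
    define w where "w = v - (\<Sum>k<n. (v \<bullet> f k) *\<^sub>R f k)"
    have "w \<noteq> 0"
    proof
      assume "w = 0"
      then have "v = (\<Sum>k<n. (v \<bullet> f k) *\<^sub>R f k)" unfolding w_def by simp
      moreover have "(\<Sum>k<n. (v \<bullet> f k) *\<^sub>R f k) \<in> span (f ` {..<n})"
        by (intro span_sum span_scale span_base) auto
      ultimately show False using v by simp
    qed
    moreover have "w \<bullet> f j = 0" if "j < n" for j
    proof -
      have "(\<Sum>k<n. (v \<bullet> f k) * (f k \<bullet> f j)) = (\<Sum>k<n. if k = j then v \<bullet> f j else 0)"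
        using that by (intro sum.cong) (auto simp: orth)
      then show ?thesis unfolding w_def using that by (simp add: inner_diff_left inner_sum_left)
    qed
    ultimately show "\<exists>r. norm r = 1 \<and> (\<forall>k<n. r \<bullet> f k = 0)"
      by (intro exI[of _ "(1 / norm w) *\<^sub>R w"]) simp
  qed simp
  then obtain f :: "nat \<Rightarrow> 'a" where f: "\<And>n. norm (f n) = 1" "\<And>n k. k < n \<Longrightarrow> f n \<bullet> f k = 0" by blast
  have "f i \<bullet> f j = (if i = j then 1 else 0)" for i j
    using f by (metis dot_square_norm inner_commute linorder_neqE_nat power_one)
  then show ?thesis using that by blast
qed

text \<open>Bessel's inequality, from |y - p|^2 >= 0 for the partial expansions
  \<open>p\<close>.\<close>

lemma orthonormal_inner_tendsto_zero:
  fixes e :: "nat \<Rightarrow> 'a::real_inner"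
  assumes "\<And>i j. e i \<bullet> e j = (if i = j then 1 else 0)"
  shows "(\<lambda>i. y \<bullet> e i) \<longlonglongrightarrow> 0"
proof -
  have "summable (\<lambda>i. (y \<bullet> e i)\<^sup>2)"
  proof (rule summableI_nonneg_bounded)
    fix n
    define p where "p = (\<Sum>i<n. (y \<bullet> e i) *\<^sub>R e i)"
    have ype: "y \<bullet> p = (\<Sum>i<n. (y \<bullet> e i)\<^sup>2)"
      unfolding p_def by (simp add: inner_sum_right power2_eq_square)
    have "p \<bullet> e i = y \<bullet> e i" if "i < n" for i
      unfolding p_def using that by (simp add: inner_sum_left assms if_distrib cong: if_cong)
    then have "p \<bullet> p = (\<Sum>i<n. (y \<bullet> e i)\<^sup>2)"
      by (subst (2) p_def) (simp add: inner_sum_right power2_eq_square)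
    moreover have "0 \<le> (y - p) \<bullet> (y - p)" by simp
    ultimately show "(\<Sum>i<n. (y \<bullet> e i)\<^sup>2) \<le> y \<bullet> y"
      using ype by (simp add: inner_diff_left inner_diff_right inner_commute)
  qed simp
  then have "(\<lambda>i. (y \<bullet> e i)\<^sup>2) \<longlonglongrightarrow> 0" by (rule summable_LIMSEQ_zero)
  from tendsto_real_sqrt[OF this] have "(\<lambda>i. \<bar>y \<bullet> e i\<bar>) \<longlonglongrightarrow> 0" by simp
  then show ?thesis by (rule tendsto_rabs_zero_cancel)
qed

lemma closed_convex_hyperplane0:
  fixes \<phi> :: "'a::real_inner"
  shows "closed {y. y \<bullet> \<phi> = 0}" "convex {y. y \<bullet> \<phi> = 0}"
  using closed_hyperplane[of \<phi> 0] convex_hyperplane[of \<phi> 0] by (simp_all add: inner_commute)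

lemma
  fixes \<phi> :: "'a::real_inner"
  assumes "norm \<phi> = 1"
  shows metric_proj_hyperplane: "metric_proj {y. y \<bullet> \<phi> = 0} x = x - (x \<bullet> \<phi>) *\<^sub>R \<phi>"
    and infdist_hyperplane: "infdist x {y. y \<bullet> \<phi> = 0} = \<bar>x \<bullet> \<phi>\<bar>"
proof -
  let ?p = "x - (x \<bullet> \<phi>) *\<^sub>R \<phi>"
  have pp: "\<phi> \<bullet> \<phi> = 1" using assms by (simp add: dot_square_norm)
  have p: "?p \<in> {y. y \<bullet> \<phi> = 0}" by (simp add: inner_diff_left pp)
  have n: "norm (x - ?p) = \<bar>x \<bullet> \<phi>\<bar>" using assms by simp
  have le: "\<bar>x \<bullet> \<phi>\<bar> \<le> norm (x - z)" if "z \<in> {y. y \<bullet> \<phi> = 0}" for z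
    using that Cauchy_Schwarz_ineq2[of "x - z" \<phi>] assms by (simp add: inner_diff_left)
  show "metric_proj {y. y \<bullet> \<phi> = 0} x = ?p"
    using le by (intro metric_proj_eqI closed_convex_hyperplane0 p) (simp only: n)
  have "infdist x {y. y \<bullet> \<phi> = 0} = (INF z\<in>{y. y \<bullet> \<phi> = 0}. dist x z)"
    using p by (intro infdist_notempty) blast
  also have "\<dots> = \<bar>x \<bullet> \<phi>\<bar>"
  proof (rule cInf_eq_minimum)
    show "\<bar>x \<bullet> \<phi>\<bar> \<in> dist x ` {y. y \<bullet> \<phi> = 0}"
      using p n by (intro image_eqI[of _ _ ?p]) (simp_all add: dist_norm)
  qed (use le in \<open>auto simp: dist_norm\<close>)
  finally show "infdist x {y. y \<bullet> \<phi> = 0} = \<bar>x \<bullet> \<phi>\<bar>" .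
qed

section \<open>Splitting the largest coordinate\<close>

definition max_coord :: "(nat \<Rightarrow> real) \<Rightarrow> nat \<Rightarrow> real" where
  "max_coord w L = Max (w ` {..L})"

text \<open>Coordinates below \<open>L\<close> are deleted or comparable to the maximum; coordinate \<open>L\<close> is the one
  that currently receives mass.\<close>
definition balanced :: "(nat \<Rightarrow> real) \<Rightarrow> nat \<Rightarrow> bool" where
  "balanced w L \<longleftrightarrow> 0 < L \<and> (\<forall>k. 0 \<le> w k) \<and> (\<forall>k>L. w k = 0) \<and>
     (\<forall>k<L. w k = 0 \<or> max_coord w L \<le> 5 * w k) \<and> 5 * w L \<le> max_coord w L"

text \<open>The projection of \<open>\<Sum>k\<le>L. w k e\<^sub>k\<close> onto the hyperplane orthogonal to \<open>A e\<^sub>p - B e\<^sub>L\<close>.\<close>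
definition shift_mass :: "(nat \<Rightarrow> real) \<Rightarrow> nat \<Rightarrow> nat \<Rightarrow> real \<Rightarrow> real \<Rightarrow> nat \<Rightarrow> real" where
  "shift_mass w L p A B = w(p := w p - (A * w p - B * w L) * A, L := w L + (A * w p - B * w L) * B)"

lemma max_coord_ge: "k \<le> L \<Longrightarrow> w k \<le> max_coord w L"
  unfolding max_coord_def by (rule Max_ge) auto

lemma max_coord_le: "(\<And>k. k \<le> L \<Longrightarrow> w k \<le> m) \<Longrightarrow> max_coord w L \<le> m"
  unfolding max_coord_def by (subst Max_le_iff) auto

lemma balanced_le_max_coord: "balanced w L \<Longrightarrow> w k \<le> max_coord w L"
  using max_coord_ge[of k L w] max_coord_ge[of 0 L w] unfolding balanced_def
  by (cases "k \<le> L") (force simp: not_le)+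

lemma balanced_max_coord_nonneg: "balanced w L \<Longrightarrow> 0 \<le> max_coord w L"
  using balanced_le_max_coord[of w L 0] unfolding balanced_def by (meson order_trans)

text \<open>The receiving coordinate is at most a fifth of the maximum, so it can be a maximizer
  only if all coordinates vanish, and then index 0 serves.\<close>

lemma balanced_argmax:
  assumes "balanced w L"
  obtains p where "p < L" "w p = max_coord w L"
proof -
  have "max_coord w L \<in> w ` {..L}" unfolding max_coord_def by (rule Max_in) auto
  then obtain p where p: "p \<le> L" "w p = max_coord w L" by auto
  show ?thesis
  proof (cases "p = L")
    case True
    then have "max_coord w L = 0"
      using p assms balanced_max_coord_nonneg[OF assms] unfolding balanced_def by auto
    moreover have "w 0 \<le> max_coord w L" by (rule balanced_le_max_coord[OF assms])
    ultimately show ?thesis using assms that[of 0] unfolding balanced_def by (simp add: order_antisym)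
  next
    case False
    then show ?thesis using p that[of p] by simp
  qed
qed

text \<open>Once coordinate \<open>L\<close> exceeds a fifth of the maximum it counts as comparable,
  and the fresh zero coordinate \<open>Suc L\<close> becomes the receiver.\<close>

lemma balanced_extend:
  assumes "0 < L" "\<And>k. 0 \<le> w k" "\<And>k. L < k \<Longrightarrow> w k = 0"
    "\<And>k. k < L \<Longrightarrow> w k = 0 \<or> max_coord w L \<le> 5 * w k"
  obtains L' where "L \<le> L'" "balanced w L'" "max_coord w L' = max_coord w L"
proof (cases "5 * w L \<le> max_coord w L")
  case True
  then show ?thesis using assms that[of L] unfolding balanced_def by auto
next
  case False
  have "0 \<le> max_coord w L" using assms(2)[of 0] max_coord_ge[of 0 L w] by simp
  then have M: "max_coord w (Suc L) = max_coord w L"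
    unfolding max_coord_def using assms(3)[of "Suc L"] by (simp add: atMost_Suc)
  have "balanced w (Suc L)"
    unfolding balanced_def M using assms False \<open>0 \<le> max_coord w L\<close> by (auto simp: less_Suc_eq)
  then show ?thesis using M that[of "Suc L"] by auto
qed

lemma sum_shift_mass:
  fixes f :: "real \<Rightarrow> real" and p L :: nat
  assumes "p < L"
  shows "(\<Sum>k\<le>L. f ((w(p := u, L := v)) k)) = (\<Sum>k\<le>L. f (w k)) + (f u - f (w p)) + (f v - f (w L))"
proof -
  have *: "sum h {..L} = h p + (h L + sum h ({..L} - {p} - {L}))" for h :: "nat \<Rightarrow> real"
    using assms by (subst sum.remove[of _ p], simp, simp, subst sum.remove[of _ L]) auto
  have "(\<Sum>k\<in>{..L} - {p} - {L}. f ((w(p := u, L := v)) k)) = (\<Sum>k\<in>{..L} - {p} - {L}. f (w k))"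
    by (intro sum.cong) auto
  then show ?thesis
    unfolding *[of "\<lambda>k. f ((w(p := u, L := v)) k)"] *[of "\<lambda>k. f (w k)"] using assms by simp
qed

text \<open>Balance survives if the donor is deleted or stays comparable (\<open>u\<close>) and the
  receiver does not exceed the maximum (\<open>v\<close>). The squared norm drops by g^2 because (A,
  -B) is a unit vector.\<close>

lemma balanced_shift_mass:
  assumes bal: "balanced w L" and p: "p < L" "w p = max_coord w L"
    and A: "0 \<le> A" "0 \<le> B" "A\<^sup>2 + B\<^sup>2 = 1"
    and g: "g = A * w p - B * w L" "0 \<le> g"
    and u: "w p = g * A \<or> max_coord w L \<le> 5 * (w p - g * A)"
    and v: "w L + g * B \<le> max_coord w L"
  obtains L' where "balanced (shift_mass w L p A B) L'"
    "max_coord (shift_mass w L p A B) L' \<le> max_coord w L"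
    "(\<Sum>k\<le>L'. (shift_mass w L p A B k)\<^sup>2) = (\<Sum>k\<le>L. (w k)\<^sup>2) - g\<^sup>2"
    "(\<Sum>k\<le>L'. shift_mass w L p A B k) = (\<Sum>k\<le>L. w k) - g * (A - B)"
proof -
  define w' where "w' = shift_mass w L p A B"
  have w': "w' = w(p := w p - g * A, L := w L + g * B)" unfolding w'_def shift_mass_def g(1) ..
  note M = balanced_le_max_coord[OF bal] and M0 = balanced_max_coord_nonneg[OF bal]
  have pos: "0 \<le> w k" and zero: "L < k \<Longrightarrow> w k = 0" for k using bal unfolding balanced_def by auto
  have pos': "0 \<le> w' k" for k
    unfolding w' using pos A g u M0 by (auto simp: fun_upd_def)
  have zero': "w' k = 0" if "L < k" for k unfolding w' using that zero p by simp
  have "w' k \<le> max_coord w L" for k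
    unfolding w' using M[of k] v A(1) g(2) p by (auto simp: fun_upd_def)
  then have M': "max_coord w' L \<le> max_coord w L" by (intro max_coord_le)
  have "w' k = 0 \<or> max_coord w' L \<le> 5 * w' k" if "k < L" for k
  proof (cases "k = p")
    case True
    then show ?thesis using u p M' unfolding w' by auto
  next
    case False
    then have "w' k = w k" unfolding w' using that by simp
    moreover have "w k = 0 \<or> max_coord w L \<le> 5 * w k" using bal that unfolding balanced_def by blast
    ultimately show ?thesis using M' by auto
  qed
  then obtain L' where L': "L \<le> L'" "balanced w' L'" "max_coord w' L' = max_coord w' L"
    using balanced_extend[of L w'] pos' zero' p(1) by (metis gr_zeroI less_nat_zero_code)
  have ext: "(\<Sum>k\<le>L'. f (w' k)) = (\<Sum>k\<le>L. f (w' k))" if "f 0 = 0" for f :: "real \<Rightarrow> real"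
    using L'(1) zero' that by (intro sum.mono_neutral_right) auto
  have "(w p - g * A)\<^sup>2 - (w p)\<^sup>2 + ((w L + g * B)\<^sup>2 - (w L)\<^sup>2) = g\<^sup>2 * (A\<^sup>2 + B\<^sup>2) - 2 * g * (A * w p - B * w L)"
    by (simp add: power2_eq_square algebra_simps)
  also have "\<dots> = - g\<^sup>2" unfolding A(3) g(1)[symmetric] by (simp add: power2_eq_square)
  finally have "(\<Sum>k\<le>L'. (w' k)\<^sup>2) = (\<Sum>k\<le>L. (w k)\<^sup>2) - g\<^sup>2"
    using sum_shift_mass[OF p(1), of "\<lambda>x. x\<^sup>2" w "w p - g * A" "w L + g * B"]
      ext[of "\<lambda>x. x\<^sup>2"] unfolding w' by simp
  moreover have "(\<Sum>k\<le>L'. w' k) = (\<Sum>k\<le>L. w k) - g * (A - B)"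
    using sum_shift_mass[OF p(1), of "\<lambda>x. x" w "w p - g * A" "w L + g * B"]
      ext[of "\<lambda>x. x"] unfolding w' by (simp add: algebra_simps)
  moreover have "max_coord w' L' \<le> max_coord w L" using L'(3) M' by simp
  ultimately show ?thesis using that[of L'] L'(2) unfolding w'_def by blast
qed

text \<open>The first alternative deletes the largest coordinate, which is admissible for every weakness
  parameter; the second moves mass to coordinate \<open>L\<close> and increases the sum of the coordinates.\<close>
definition greedy_step ::
    "bool \<Rightarrow> real \<Rightarrow> (nat \<Rightarrow> real) \<Rightarrow> nat \<Rightarrow> nat \<Rightarrow> real \<Rightarrow> real \<Rightarrow> (nat \<Rightarrow> real) \<Rightarrow> nat \<Rightarrow> bool" where
  "greedy_step forced b w L p A B w' L' \<longleftrightarrow>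
     (let g = A * w p - B * w L; M = max_coord w L in
      p < L \<and> 0 \<le> A \<and> 0 \<le> B \<and> A\<^sup>2 + B\<^sup>2 = 1 \<and> w' = shift_mass w L p A B \<and>
      max_coord w' L' \<le> M \<and>
      (\<Sum>k\<le>L'. (w' k)\<^sup>2) = (\<Sum>k\<le>L. (w k)\<^sup>2) - g\<^sup>2 \<and>
      (\<Sum>k\<le>L'. w' k) = (\<Sum>k\<le>L. w k) - g * (A - B) \<and>
      ((forced \<or> M < 8 * b) \<and> g = M \<and> A = 1 \<and> B = 0 \<or>
       \<not> forced \<and> b \<le> g \<and> g \<le> 2 * b \<and> b / 2 \<le> g * (B - A)))"

lemma greedy_step_exists:
  assumes bal: "balanced w L" and b: "0 < b"
  shows "\<exists>w' L'. balanced w' L' \<and> (\<exists>p A B. greedy_step forced b w L p A B w' L')"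
proof -
  obtain p where p: "p < L" "w p = max_coord w L" using balanced_argmax[OF bal] .
  define M where "M = max_coord w L"
  have M0: "0 \<le> M" unfolding M_def by (rule balanced_max_coord_nonneg[OF bal])
  have v: "0 \<le> w L" "5 * w L \<le> M" using bal unfolding balanced_def M_def by auto
  show ?thesis
  proof (cases "forced \<or> M < 8 * b")
    case True
    obtain L' where "balanced (shift_mass w L p 1 0) L'"
      "max_coord (shift_mass w L p 1 0) L' \<le> max_coord w L"
      "(\<Sum>k\<le>L'. (shift_mass w L p 1 0 k)\<^sup>2) = (\<Sum>k\<le>L. (w k)\<^sup>2) - M\<^sup>2"
      "(\<Sum>k\<le>L'. shift_mass w L p 1 0 k) = (\<Sum>k\<le>L. w k) - M * (1 - 0)"
      by (rule balanced_shift_mass[OF bal p, of 1 0 M]) (use p M0 v in \<open>auto simp: M_def\<close>)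
    then have "greedy_step forced b w L p 1 0 (shift_mass w L p 1 0) L'"
      unfolding greedy_step_def Let_def using p True by (simp add: M_def)
    with \<open>balanced (shift_mass w L p 1 0) L'\<close> show ?thesis by blast
  next
    case False
    then have bM: "8 * b \<le> M" "\<not> forced" by auto
    then have M: "0 < M" using b by linarith
    \<comment> \<open>\<tau> = A/B solves \<tau> M - w L = 2 b. From 5 w L \<le> M and 8 b \<le> M
      it is at most 1/5 + 1/4 < 1/2, which keeps B - A away from 0.\<close>
    define \<tau> where "\<tau> = w L / M + 2 * b / M"
    define D where "D = 1 + \<tau>\<^sup>2"
    define A B where "A = \<tau> / sqrt D" and "B = 1 / sqrt D"
    define g where "g = A * w p - B * w L"
    have \<tau>0: "0 \<le> \<tau>" unfolding \<tau>_def using v b M by simp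
    have \<tau>M: "\<tau> * M = w L + 2 * b" unfolding \<tau>_def using M by (simp add: field_simps)
    then have "\<tau> * M \<le> (1/2) * M" using v bM by linarith
    then have \<tau>: "\<tau> \<le> 1/2" using M by simp
    have D1: "1 \<le> D" unfolding D_def by simp
    have "\<tau>\<^sup>2 \<le> (1/2)\<^sup>2" using \<tau> \<tau>0 by (rule power_mono)
    then have D2: "D \<le> 5/4" unfolding D_def by (simp add: power2_eq_square)
    have sD: "0 < sqrt D" "sqrt D * sqrt D = D" using D1 by simp_all
    have s1: "1 \<le> sqrt D" using D1 by simp
    have s2: "sqrt D \<le> 2" using D2 by (intro real_le_lsqrt) auto
    have AB: "0 \<le> A" "0 \<le> B" "A\<^sup>2 + B\<^sup>2 = 1"
    proof -
      show "0 \<le> A" "0 \<le> B" unfolding A_def B_def using \<tau>0 sD by auto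
      have "A\<^sup>2 + B\<^sup>2 = (\<tau>\<^sup>2 + 1) / D" unfolding A_def B_def using D1
        by (simp add: power_divide add_divide_distrib)
      also have "\<tau>\<^sup>2 + 1 = D" by (simp add: D_def)
      also have "D / D = 1" using D1 by simp
      finally show "A\<^sup>2 + B\<^sup>2 = 1" .
    qed
    have g: "g = 2 * b / sqrt D"
    proof -
      have "g = (\<tau> * M - w L) / sqrt D"
        unfolding g_def A_def B_def p(2) M_def[symmetric] by (simp add: diff_divide_distrib)
      then show ?thesis using \<tau>M by simp
    qed
    have gB: "g * B = 2 * b / D" unfolding g B_def using sD by simp
    have gA: "g * A = 2 * b / D * \<tau>" unfolding g A_def using sD by simp
    have q1: "2 * b / D \<le> 2 * b" using D1 b by (simp add: divide_le_eq)
    \<comment> \<open>8/5 = 2/(5/4) from D \<le> 5/4; with 1 - \<tau> \<ge> 1/2 the gain g (B - A)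
      is at least 4b/5.\<close>
    have q2: "(8/5) * b \<le> 2 * b / D" using D1 D2 b by (simp add: le_divide_eq)
    have q0: "0 \<le> 2 * b / D" using D1 b by simp
    have gAb: "g * A \<le> b" unfolding gA using mult_mono[OF q1 \<tau>] \<tau>0 b by simp
    have "5 * (w p - g * A) = 5 * M - 5 * (g * A)" by (simp add: p M_def)
    with gAb bM b have u: "M \<le> 5 * (w p - g * A)" by linarith
    have v': "w L + g * B \<le> M" unfolding gB using q1 v bM by linarith
    have g0: "0 \<le> g" unfolding g using b sD by simp
    have gb: "b \<le> g" "g \<le> 2 * b"
      unfolding g using b s1 s2 sD by (simp_all add: le_divide_eq divide_le_eq)
    have "b / 2 \<le> (8/5) * b * (1/2)" using b by simp
    also have "\<dots> \<le> 2 * b / D * (1 - \<tau>)" using q2 \<tau> q0 b by (intro mult_mono) auto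
    also have "\<dots> = g * (B - A)" by (simp only: right_diff_distrib gA gB mult_1_right)
    finally have inc: "b / 2 \<le> g * (B - A)" .
    obtain L' where "balanced (shift_mass w L p A B) L'"
      "max_coord (shift_mass w L p A B) L' \<le> max_coord w L"
      "(\<Sum>k\<le>L'. (shift_mass w L p A B k)\<^sup>2) = (\<Sum>k\<le>L. (w k)\<^sup>2) - g\<^sup>2"
      "(\<Sum>k\<le>L'. shift_mass w L p A B k) = (\<Sum>k\<le>L. w k) - g * (A - B)"
      using balanced_shift_mass[OF bal p AB g_def g0] u v' unfolding M_def by blast
    then have "greedy_step forced b w L p A B (shift_mass w L p A B) L'"
      unfolding greedy_step_def Let_def using p AB bM gb inc by (simp add: g_def)
    with \<open>balanced (shift_mass w L p A B) L'\<close> show ?thesis by blast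
  qed
qed

section \<open>The greedy iteration: largest coordinate against the sum of coordinates\<close>

lemma sum_squares_le_max_coord_sum:
  assumes "balanced w L"
  shows "(\<Sum>k\<le>L. (w k)\<^sup>2) \<le> max_coord w L * (\<Sum>k\<le>L. w k)"
  unfolding sum_distrib_left power2_eq_square
  using assms balanced_le_max_coord[OF assms] by (intro sum_mono mult_right_mono) (auto simp: balanced_def)

text \<open>A nonzero coordinate below \<open>L\<close> satisfies M w k \<le> 5 (w k)^2, so these
  contribute at most 5; the receiver, possibly tiny, contributes at most 1.\<close>

lemma max_coord_sum_le:
  assumes bal: "balanced w L" and "(\<Sum>k\<le>L. (w k)\<^sup>2) \<le> 1" "max_coord w L \<le> 1"
  shows "max_coord w L * (\<Sum>k\<le>L. w k) \<le> 6"
proof -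
  define M where "M = max_coord w L"
  have M: "0 \<le> M" "M \<le> 1" unfolding M_def using assms balanced_max_coord_nonneg by auto
  have split: "sum h {..L} = sum h {..<L} + h L" for h :: "nat \<Rightarrow> real"
    by (simp flip: lessThan_Suc_atMost)
  have "M * w k \<le> 5 * (w k)\<^sup>2" if "k < L" for k
  proof -
    have "w k = 0 \<or> M \<le> 5 * w k" "0 \<le> w k" using bal that unfolding balanced_def M_def by auto
    then show ?thesis using mult_right_mono[of M "5 * w k" "w k"] by (auto simp: power2_eq_square)
  qed
  then have "(\<Sum>k<L. M * w k) \<le> (\<Sum>k<L. 5 * (w k)\<^sup>2)" by (intro sum_mono) auto
  also have "\<dots> = 5 * (\<Sum>k<L. (w k)\<^sup>2)" by (simp add: sum_distrib_left)
  also have "\<dots> \<le> 5" using assms(2) split[of "\<lambda>k. (w k)\<^sup>2"] zero_le_power2[of "w L"] by linarith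
  finally have "(\<Sum>k<L. M * w k) \<le> 5" .
  moreover have "M * w L \<le> 1"
  proof -
    have "w L \<le> M" "0 \<le> w L" using bal balanced_le_max_coord unfolding balanced_def M_def by auto
    then have "M * w L \<le> 1 * 1" using M by (intro mult_mono) auto
    then show ?thesis by simp
  qed
  ultimately show ?thesis
    unfolding M_def[symmetric] split[of w] by (simp add: distrib_left sum_distrib_left)
qed

lemma greedy_coordinates:
  fixes t b :: "nat \<Rightarrow> real"
  defines "\<sigma> \<equiv> \<lambda>n. \<Sum>k<n. b k"
  assumes t: "\<And>n. 0 \<le> t n" "\<And>n. t n \<le> 1"
    and b: "\<And>n. 0 < b n"
    and tail': "\<forall>n\<ge>n0. (\<Sum>k=n0..<n. (b k)\<^sup>2) \<le> 1 / 576"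
    and tb': "\<forall>n\<ge>n0. 24 * t n \<le> b n * \<sigma> n"
    and \<sigma>: "filterlim \<sigma> at_top sequentially"
  shows "\<exists>w L p A B. (\<forall>n. balanced (w n) (L n) \<and> p n < L n \<and> 0 \<le> A n \<and> 0 \<le> B n \<and>
      (A n)\<^sup>2 + (B n)\<^sup>2 = 1 \<and> w (Suc n) = shift_mass (w n) (L n) (p n) (A n) (B n) \<and>
      t n * max_coord (w n) (L n) \<le> A n * w n (p n) - B n * w n (L n) \<and>
      1 / 4 \<le> (\<Sum>k\<le>L n. (w n k)\<^sup>2)) \<and>
    filterlim L at_top sequentially"
proof -
  note tail = tail'[rule_format] and tb = tb'[rule_format]
  \<comment> \<open>The forced deletions cost at most n0/q \<le> 1/2 in \<open>F\<close> and in
    \<open>S\<close>, starting from 1 and q; q \<ge> \<sigma> n0 makes \<open>S n0\<close> at least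
    \<sigma> n0 / 2.\<close>
  obtain q where q: "2 * n0 + 1 \<le> q" "\<sigma> n0 \<le> real q"
  proof -
    obtain q1 where "\<sigma> n0 < real q1" using reals_Archimedean2 by blast
    then show ?thesis using that[of "max (2 * n0 + 1) q1"] by simp
  qed
  have q1: "1 \<le> real q" using q(1) by simp
  \<comment> \<open>Enough equal coordinates to delete one of them in each of the first \<open>n0\<close> steps.\<close>
  define w0 :: "nat \<Rightarrow> real" where "w0 k = (if k < q\<^sup>2 then 1 / q else 0)" for k
  have q2: "0 < q\<^sup>2" using q(1) by simp
  have M0: "max_coord w0 (q\<^sup>2) = 1 / q"
    unfolding max_coord_def by (rule Max_eqI) (use q2 in \<open>auto simp: w0_def image_iff intro!: bexI[of _ 0]\<close>)
  have bal0: "balanced w0 (q\<^sup>2)"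
    unfolding balanced_def M0 using q2 by (simp add: w0_def divide_right_mono)
  have sum0: "(\<Sum>k\<le>q\<^sup>2. f (w0 k)) = real (q\<^sup>2) * f (1 / q)" if "f 0 = 0" for f :: "real \<Rightarrow> real"
  proof -
    have "(\<Sum>k\<le>q\<^sup>2. f (w0 k)) = (\<Sum>k<q\<^sup>2. f (w0 k))"
      using that by (intro sum.mono_neutral_right) (auto simp: w0_def)
    also have "\<dots> = (\<Sum>k<q\<^sup>2. f (1 / q))" by (intro sum.cong) (auto simp: w0_def)
    finally show ?thesis by simp
  qed
  let ?P = "\<lambda>n :: nat. \<lambda>s. balanced (fst s) (snd s) \<and> (n = 0 \<longrightarrow> s = (w0, q\<^sup>2))"
  let ?Q = "\<lambda>n :: nat. \<lambda>s s'. \<exists>p A B. greedy_step (n < n0) (b n) (fst s) (snd s) p A B (fst s') (snd s')"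
  have "\<exists>f. \<forall>n. ?P n (f n) \<and> ?Q n (f n) (f (Suc n))"
  proof (rule dependent_nat_choice)
    show "\<exists>s. ?P 0 s" using bal0 by auto
    fix s :: "(nat \<Rightarrow> real) \<times> nat" and n :: nat assume "?P n s"
    then obtain w' L' where "balanced w' L'" "\<exists>p A B. greedy_step (n < n0) (b n) (fst s) (snd s) p A B w' L'"
      using greedy_step_exists[OF _ b[of n], of "fst s" "snd s" "n < n0"] by blast
    then show "\<exists>s'. ?P (Suc n) s' \<and> ?Q n s s'" by (intro exI[of _ "(w', L')"]) auto
  qed
  then obtain f where f: "\<And>n. ?P n (f n)" "\<And>n. ?Q n (f n) (f (Suc n))" by blast
  define w L where "w n = fst (f n)" and "L n = snd (f n)" for n
  have bal: "balanced (w n) (L n)" for n unfolding w_def L_def using f(1) by blast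
  have init: "w 0 = w0" "L 0 = q\<^sup>2" unfolding w_def L_def using f(1)[of 0] by auto
  obtain p A B where step: "\<And>n. greedy_step (n < n0) (b n) (w n) (L n) (p n) (A n) (B n) (w (Suc n)) (L (Suc n))"
    using f(2) unfolding w_def L_def by metis
  define M S F g where "M n = max_coord (w n) (L n)" and "S n = (\<Sum>k\<le>L n. w n k)"
    and "F n = (\<Sum>k\<le>L n. (w n k)\<^sup>2)" and "g n = A n * w n (p n) - B n * w n (L n)" for n
  have p: "p n < L n" and A: "0 \<le> A n" and B: "0 \<le> B n" and AB: "(A n)\<^sup>2 + (B n)\<^sup>2 = 1"
    and w': "w (Suc n) = shift_mass (w n) (L n) (p n) (A n) (B n)"
    and Mdec: "M (Suc n) \<le> M n"
    and F': "F (Suc n) = F n - (g n)\<^sup>2" and S': "S (Suc n) = S n - g n * (A n - B n)"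
    and cases: "(n < n0 \<or> M n < 8 * b n) \<and> g n = M n \<and> A n = 1 \<and> B n = 0 \<or>
       \<not> n < n0 \<and> b n \<le> g n \<and> g n \<le> 2 * b n \<and> b n / 2 \<le> g n * (B n - A n)" for n
    using step[of n] unfolding greedy_step_def Let_def M_def S_def F_def g_def by blast+
  have Mpos: "0 \<le> M n" for n unfolding M_def by (rule balanced_max_coord_nonneg[OF bal])
  have wpos: "0 \<le> w n k" for n k using bal[of n] unfolding balanced_def by blast
  have Spos: "0 \<le> S n" for n unfolding S_def by (intro sum_nonneg wpos)
  have Mle: "M n \<le> 1 / q" for n
    by (induction n) (use Mdec M0 init in \<open>auto simp: M_def intro: order_trans\<close>)
  have "1 / real q \<le> 1" using q1 by simp
  then have M1: "M n \<le> 1" for n using Mle[of n] by linarith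
  have F0: "F 0 = 1" unfolding F_def init using sum0[of "\<lambda>x. x\<^sup>2"] q1 by (simp add: power_divide)
  have S0: "S 0 = q" unfolding S_def init using sum0[of "\<lambda>x. x"] q1 by (simp add: power2_eq_square)
  have F1: "F n \<le> 1" for n
  proof (induction n)
    case (Suc n) then show ?case unfolding F' using zero_le_power2[of "g n"] by linarith
  qed (simp add: F0)
  have MS: "M n * S n \<le> 6" for n
    unfolding M_def S_def by (rule max_coord_sum_le[OF bal]) (use F1 M1 in \<open>simp_all add: F_def M_def\<close>)
  have FMS: "F n \<le> M n * S n" for n
    unfolding F_def M_def S_def by (rule sum_squares_le_max_coord_sum[OF bal])
  have early: "1 - n / q \<le> F n \<and> q - n / q \<le> S n" if "n \<le> n0" for n
    using that
  proof (induction n)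
    case 0 then show ?case by (simp add: F0 S0)
  next
    case (Suc n)
    then have g: "g n = M n" "A n = 1" "B n = 0" using cases[of n] by auto
    have "(M n)\<^sup>2 \<le> M n" using Mpos[of n] M1[of n] by (simp add: power2_eq_square mult_left_le)
    then show ?case using Suc Mle[of n] unfolding F' S' g by (simp add: add_divide_distrib)
  qed
  have n0q: "n0 / q \<le> 1 / 2" using q(1) q1 by (simp add: divide_le_eq)
  have Fn0: "1/2 \<le> F n0" using early[of n0] n0q by linarith
  have Sn0: "q / 2 \<le> S n0" using early[of n0] n0q q1 by linarith
  define E where "E n = (\<Sum>k=n0..<n. (b k)\<^sup>2)" for n
  have E': "E (Suc n) = E n + (b n)\<^sup>2" if "n0 \<le> n" for n unfolding E_def using that by simp
  have Epos: "0 \<le> E n" for n unfolding E_def by (intro sum_nonneg) simp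
  \<comment> \<open>A deletion after \<open>n0\<close> has g = M < 8 b, a shift has g \<le> 2 b, so
    each step costs at most 64 b^2; in total at most 64/576 < 1/4.\<close>
  have late: "1 / 2 - 64 * E n \<le> F n" if "n0 \<le> n" for n
    using that
  proof (induction n rule: dec_induct)
    case base then show ?case using Fn0 by (simp add: E_def)
  next
    case (step n)
    have "0 \<le> g n" "g n \<le> 8 * b n" using cases[of n] Mpos[of n] b[of n] step by auto
    then have "(g n)\<^sup>2 \<le> (8 * b n)\<^sup>2" by (intro power_mono)
    then show ?case using step unfolding F' E'[OF step(1)] by (simp add: power_mult_distrib)
  qed
  have F4: "1 / 4 \<le> F n" for n
  proof (cases "n \<le> n0")
    case True
    then have "n / q \<le> n0 / q" by (intro divide_right_mono) auto
    then show ?thesis using early[OF True] n0q by linarith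
  next
    case False
    then show ?thesis using late[of n] tail[of n] unfolding E_def by simp
  qed
  \<comment> \<open>A deletion costs at most \<open>M n < 8 * b n\<close>, and \<open>1/4 \<le> M n * S n\<close> turns this into a relative
    loss of order \<open>(b n)\<^sup>2\<close>.\<close>
  have Sstep: "S n * (1 - 288 * (b n)\<^sup>2) + b n / 2 \<le> S (Suc n)" if "n0 \<le> n" for n
  proof -
    have nn: "0 \<le> S n * (b n)\<^sup>2" using Spos by simp
    consider "M n < 8 * b n" "g n = M n" "A n = 1" "B n = 0" | "b n / 2 \<le> g n * (B n - A n)"
      using cases[of n] \<open>n0 \<le> n\<close> leD by blast
    then show ?thesis
    proof cases
      case 1
      have "1 / 4 \<le> M n * S n" using F4[of n] FMS[of n] by linarith
      also have "\<dots> \<le> 8 * b n * S n" using 1 Spos by (intro mult_right_mono) auto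
      finally have "b n * 1 \<le> b n * (32 * b n * S n)" using b[of n] by (intro mult_left_mono) auto
      then have "b n \<le> 32 * (S n * (b n)\<^sup>2)" by (simp add: power2_eq_square mult_ac)
      \<comment> \<open>Losing \<open>M n\<close> and still granting the gain b/2 requires less than
        9 b, and 288 = 9 * 32.\<close>
      then have "S n - 288 * (S n * (b n)\<^sup>2) + b n / 2 \<le> S (Suc n)"
        using 1(1) b[of n] nn unfolding S' 1(2-) by simp
      then show ?thesis by (simp add: right_diff_distrib mult_ac)
    next
      case 2
      then have "S n - 288 * (S n * (b n)\<^sup>2) + b n / 2 \<le> S (Suc n)"
        using nn unfolding S' by (simp add: algebra_simps)
      then show ?thesis by (simp add: right_diff_distrib mult_ac)
    qed
  qed
  have \<sigma>': "\<sigma> (Suc n) = \<sigma> n + b n" for n unfolding \<sigma>_def by simp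
  have \<sigma>mono: "\<sigma> n0 \<le> \<sigma> n" if "n0 \<le> n" for n
    unfolding \<sigma>_def using that b less_imp_le by (intro sum_mono2) auto
  have E2: "288 * E n \<le> 1 / 2" if "n0 \<le> n" for n using tail[OF that] unfolding E_def by simp
  \<comment> \<open>The recursion is unrolled with the relative losses collected additively, by (1 -
    x)(1 - y) \<ge> 1 - x - y for nonnegative x, y.\<close>
  have Slow: "(1 - 288 * E n) * (S n0 + (\<sigma> n - \<sigma> n0) / 2) \<le> S n" if "n0 \<le> n" for n
    using that
  proof (induction n rule: dec_induct)
    case base then show ?case by (simp add: E_def)
  next
    case (step n)
    define T where "T = S n0 + (\<sigma> n - \<sigma> n0) / 2"
    have Tb: "T + b n / 2 = S n0 + (\<sigma> (Suc n) - \<sigma> n0) / 2" unfolding T_def \<sigma>' by (simp add: field_simps)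
    have T: "0 \<le> T" unfolding T_def using Spos[of n0] \<sigma>mono[OF step(1)] by simp
    have e: "0 \<le> 288 * E n" "288 * E n + 288 * (b n)\<^sup>2 \<le> 1/2" "0 \<le> 288 * (b n)\<^sup>2" "0 \<le> E n"
      using Epos[of n] E2[of "Suc n"] E'[OF step(1)] step(1) by auto
    have e5: "0 \<le> 288 * (E n + (b n)\<^sup>2)" using e(4) by (intro mult_nonneg_nonneg add_nonneg_nonneg) auto
    have "(1 - 288 * E (Suc n)) * (T + b n / 2)
        = (1 - 288 * (E n + (b n)\<^sup>2)) * T + (1 - 288 * (E n + (b n)\<^sup>2)) * (b n / 2)"
      unfolding E'[OF step(1)] by (simp add: distrib_left)
    also have "\<dots> \<le> (1 - 288 * E n) * (1 - 288 * (b n)\<^sup>2) * T + b n / 2"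
    proof (rule add_mono)
      have "1 - 288 * (E n + (b n)\<^sup>2) \<le> (1 - 288 * E n) * (1 - 288 * (b n)\<^sup>2)"
        using mult_nonneg_nonneg[OF e(1,3)] by (simp add: algebra_simps)
      then show "(1 - 288 * (E n + (b n)\<^sup>2)) * T \<le> (1 - 288 * E n) * (1 - 288 * (b n)\<^sup>2) * T"
        using T by (rule mult_right_mono)
      show "(1 - 288 * (E n + (b n)\<^sup>2)) * (b n / 2) \<le> b n / 2"
        using e(2) e5 b[of n] by (intro mult_left_le_one_le) (simp_all add: distrib_left)
    qed
    also have "\<dots> = (1 - 288 * E n) * T * (1 - 288 * (b n)\<^sup>2) + b n / 2" by (simp only: mult_ac)
    also have "\<dots> \<le> S n * (1 - 288 * (b n)\<^sup>2) + b n / 2"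
      using step(3) e unfolding T_def by (intro add_right_mono mult_right_mono) linarith+
    also have "\<dots> \<le> S (Suc n)" by (rule Sstep[OF step(1)])
    finally show ?case unfolding Tb .
  qed
  have S\<sigma>: "\<sigma> n \<le> 4 * S n" if "n0 \<le> n" for n
  proof -
    \<comment> \<open>The initial value S n0 \<ge> q/2 cancels the offset \<sigma> n0 / 2.\<close>
    have "\<sigma> n / 2 \<le> S n0 + (\<sigma> n - \<sigma> n0) / 2" using Sn0 q(2) by (simp add: diff_divide_distrib)
    moreover have "0 \<le> \<sigma> n" unfolding \<sigma>_def using b less_imp_le by (intro sum_nonneg) auto
    ultimately have "1/2 * (\<sigma> n / 2) \<le> (1 - 288 * E n) * (S n0 + (\<sigma> n - \<sigma> n0) / 2)"
      using E2[OF that] by (intro mult_mono) auto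
    then show ?thesis using Slow[OF that] by linarith
  qed
  \<comment> \<open>A deletion qualifies since t \<le> 1. For a shift, M \<sigma> \<le> 4 M S \<le>
    24 and 24 t \<le> b \<sigma> give t M \<le> b \<le> g.\<close>
  have weak: "t n * M n \<le> g n" for n
  proof (cases "g n = M n")
    case True
    then show ?thesis using t[of n] Mpos[of n] by (simp add: mult_left_le_one_le)
  next
    case False
    then have n: "n0 \<le> n" "b n \<le> g n" using cases[of n] by auto
    show ?thesis
    proof (cases "t n = 0")
      case True then show ?thesis using n b[of n] by simp
    next
      case False
      then have tpos: "0 < t n" using t(1)[of n] by simp
      have "0 \<le> \<sigma> n" unfolding \<sigma>_def using b less_imp_le by (intro sum_nonneg) auto
      moreover have "\<sigma> n \<noteq> 0" using tb[OF n(1)] tpos by auto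
      ultimately have \<sigma>pos: "0 < \<sigma> n" by simp
      have "M n * \<sigma> n \<le> M n * (4 * S n)" using S\<sigma>[OF n(1)] Mpos by (intro mult_left_mono) auto
      also have "\<dots> \<le> 24" using MS[of n] by simp
      finally have "t n * (M n * \<sigma> n) \<le> t n * 24" using tpos by (intro mult_left_mono) auto
      then have "t n * M n * \<sigma> n \<le> b n * \<sigma> n" using tb[OF n(1)] by (simp add: mult_ac)
      then have "t n * M n \<le> b n" using \<sigma>pos by simp
      then show ?thesis using n by linarith
    qed
  qed
  \<comment> \<open>All coordinates are at most 1, so \<sigma>/4 \<le> S \<le> L + 1.\<close>
  have "filterlim (\<lambda>n. real (L n)) at_top sequentially"
  proof (rule filterlim_at_top_mono)
    show "filterlim (\<lambda>n. -1 + (1/4) * \<sigma> n) at_top sequentially"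
      by (intro filterlim_tendsto_add_at_top[OF tendsto_const]
          filterlim_tendsto_pos_mult_at_top[OF tendsto_const _ \<sigma>]) simp
    have "-1 + (1/4) * \<sigma> n \<le> real (L n)" if "n0 \<le> n" for n
    proof -
      have "w n k \<le> 1" for k using balanced_le_max_coord[OF bal, of n k] M1[of n] unfolding M_def by linarith
      then have "S n \<le> (\<Sum>k\<le>L n. 1)" unfolding S_def by (intro sum_mono) auto
      then show ?thesis using S\<sigma>[OF that] by simp
    qed
    then show "\<forall>\<^sub>F n in sequentially. -1 + (1/4) * \<sigma> n \<le> real (L n)"
      by (auto simp: eventually_sequentially)
  qed
  then have "filterlim L at_top sequentially"
    by (simp add: filterlim_at_top eventually_sequentially) (metis of_nat_le_iff)
  then show ?thesis
    using bal p A B AB w' weak F4 unfolding M_def F_def g_def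
    by (intro exI[of _ w] exI[of _ L] exI[of _ p] exI[of _ A] exI[of _ B]) simp
qed

section \<open>Convergence implies condition (T)\<close>

text \<open>A sequence violating (T) is regularized: adding 1/(n+1) makes it positive with divergent
  sum without leaving l_2, and rescaling adjusts the constant.\<close>

lemma not_condition_T_obtain:
  assumes t: "\<And>n. 0 \<le> t n" and "\<not> condition_T t"
  obtains b :: "nat \<Rightarrow> real" and n0 where "\<And>n. 0 < b n"
    "\<forall>n\<ge>n0. (\<Sum>k=n0..<n. (b k)\<^sup>2) \<le> 1 / 576"
    "\<forall>n\<ge>n0. 24 * t n \<le> b n * (\<Sum>k<n. b k)"
    "filterlim (\<lambda>n. \<Sum>k<n. b k) at_top sequentially"
proof -
  define s :: "(nat \<Rightarrow> real) \<Rightarrow> nat \<Rightarrow> real" where "s a m = (\<Sum>\<nu>=1..m. a \<nu>)" for a m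
  obtain a :: "nat \<Rightarrow> real" where a: "\<And>\<nu>. 1 \<le> \<nu> \<Longrightarrow> 0 \<le> a \<nu>" "summable (\<lambda>\<nu>. (a \<nu>)\<^sup>2)"
    and lim: "liminf (\<lambda>m. ereal (a m) / ereal (t m) * ereal (s a m)) \<noteq> 0"
    using assms(2) unfolding condition_T_def s_def by blast
  let ?f = "\<lambda>m. ereal (a m) / ereal (t m) * ereal (s a m)"
  have spos: "0 \<le> s a m" for m unfolding s_def using a(1) by (intro sum_nonneg) auto
  have fpos: "0 \<le> ?f m" if "1 \<le> m" for m
    using a(1)[OF that] t[of m] spos[of m] by (cases "t m = 0") auto
  \<comment> \<open>Index 0 is avoided because the sign of \<open>a 0\<close> is unknown; for the
    same reason \<open>b0\<close> takes absolute values.\<close>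
  have "0 \<le> liminf ?f" by (intro Liminf_bounded eventually_sequentiallyI[of 1] fpos)
  with lim have "0 < liminf ?f" by simp
  then obtain c where c: "0 < c" "ereal c < liminf ?f"
    using ereal_dense2[of 0 "liminf ?f"] by (auto simp: zero_ereal_def)
  from less_LiminfD[OF c(2)] obtain n1 where n1: "\<And>m. n1 \<le> m \<Longrightarrow> ereal c < ?f m"
    unfolding eventually_sequentially by blast
  have ct: "c * t m \<le> a m * s a m" if "n1 \<le> m" "1 \<le> m" for m
  proof (cases "t m = 0")
    case True then show ?thesis using a(1)[OF that(2)] spos[of m] by simp
  next
    case False
    then have "0 < t m" using t[of m] by simp
    then have "c < a m * s a m / t m" using n1[OF that(1)] by simp
    then show ?thesis using \<open>0 < t m\<close> by (simp add: field_simps)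
  qed
  define b0 where "b0 n = \<bar>a n\<bar> + inverse (real (Suc n))" for n
  have b0: "0 < b0 n" for n unfolding b0_def by (simp add: add_nonneg_pos)
  have b0s: "summable (\<lambda>n. (b0 n)\<^sup>2)"
  proof (rule summable_comparison_test)
    have "summable (\<lambda>n. inverse (real (Suc n) ^ 2))"
      using inverse_power_summable[of 2, where 'a = real] by (subst summable_Suc_iff) simp
    then show "summable (\<lambda>n. 2 * (a n)\<^sup>2 + 2 * inverse (real (Suc n) ^ 2))"
      by (intro summable_add summable_mult a)
    have "(b0 n)\<^sup>2 \<le> 2 * (a n)\<^sup>2 + 2 * inverse (real (Suc n) ^ 2)" for n
      using sum_squares_bound[of "\<bar>a n\<bar>" "inverse (real (Suc n))"]
      unfolding b0_def power2_sum power_inverse[symmetric] by simp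
    then show "\<exists>N. \<forall>n\<ge>N. norm ((b0 n)\<^sup>2) \<le> 2 * (a n)\<^sup>2 + 2 * inverse (real (Suc n) ^ 2)" by auto
  qed
  define \<sigma>0 where "\<sigma>0 n = (\<Sum>k<n. b0 k)" for n
  have \<sigma>0: "filterlim \<sigma>0 at_top sequentially"
  proof (rule filterlim_at_top_mono)
    show "filterlim (harm :: nat \<Rightarrow> real) at_top sequentially" by (rule harm_at_top)
    have "harm n \<le> \<sigma>0 n" for n
    proof -
      have "harm n = (\<Sum>k<n. inverse (real (Suc k)))"
        unfolding harm_def by (rule sum.reindex_bij_witness[of _ Suc "\<lambda>k. k - 1"]) auto
      also have "\<dots> \<le> \<sigma>0 n" unfolding \<sigma>0_def b0_def by (intro sum_mono) simp
      finally show ?thesis .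
    qed
    then show "\<forall>\<^sub>F n in sequentially. harm n \<le> \<sigma>0 n" by simp
  qed
  \<comment> \<open>The sum in (T) includes its last index, \<open>\<sigma>0\<close> does not; since
    b0 tends to 0 the missing term is eventually absorbed by a factor 2.\<close>
  have "(\<lambda>n. sqrt ((b0 n)\<^sup>2)) \<longlonglongrightarrow> sqrt 0"
    by (intro tendsto_real_sqrt summable_LIMSEQ_zero b0s)
  then have "b0 \<longlonglongrightarrow> 0" using b0 by (simp add: less_imp_le)
  then have "\<forall>\<^sub>F n in sequentially. b0 n < 1" by (rule order_tendstoD) simp
  moreover have "\<forall>\<^sub>F n in sequentially. 1 \<le> \<sigma>0 n"
    using \<sigma>0 by (simp add: filterlim_at_top)
  ultimately have "\<forall>\<^sub>F n in sequentially. b0 n \<le> \<sigma>0 n" by eventually_elim simp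
  then obtain n2 where n2: "\<And>n. n2 \<le> n \<Longrightarrow> b0 n \<le> \<sigma>0 n" unfolding eventually_sequentially by blast
  \<comment> \<open>Rescaling multiplies b0 \<sigma>0 by \<kappa>^2; 48 is 24 times the factor 2
    just lost.\<close>
  define \<kappa> where "\<kappa> = sqrt (48 / c)"
  have \<kappa>: "0 < \<kappa>" "\<kappa>\<^sup>2 = 48 / c" unfolding \<kappa>_def using c by simp_all
  define b where "b n = \<kappa> * b0 n" for n
  have sumb: "(\<Sum>k<n. b k) = \<kappa> * \<sigma>0 n" for n unfolding b_def \<sigma>0_def by (simp add: sum_distrib_left)
  have "summable (\<lambda>n. (b n)\<^sup>2)" unfolding b_def power_mult_distrib by (intro summable_mult b0s)
  then obtain n3 where n3: "\<And>m n. n3 \<le> m \<Longrightarrow> norm (\<Sum>k=m..<n. (b k)\<^sup>2) < 1 / 576"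
    unfolding summable_Cauchy by (metis zero_less_divide_1_iff zero_less_numeral)
  define n0 where "n0 = Max {1, n1, n2, n3}"
  have n0: "1 \<le> n0" "n1 \<le> n0" "n2 \<le> n0" "n3 \<le> n0" unfolding n0_def by simp_all
  show ?thesis
  proof (rule that[of b n0])
    show "0 < b n" for n unfolding b_def using \<kappa> b0 by simp
    show "\<forall>n\<ge>n0. (\<Sum>k=n0..<n. (b k)\<^sup>2) \<le> 1 / 576" 
      using less_imp_le[OF le_less_trans[OF abs_ge_self n3[OF n0(4), unfolded real_norm_def]]] by blast
    show "\<forall>n\<ge>n0. 24 * t n \<le> b n * (\<Sum>k<n. b k)"
    proof (intro allI impI)
      fix n assume n: "n0 \<le> n"
      have n': "1 \<le> n" "n1 \<le> n" "n2 \<le> n" using n n0 by auto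
      have "s a n \<le> (\<Sum>k\<in>{1..n}. b0 k)" unfolding s_def b0_def by (intro sum_mono) (simp add: add_increasing2)
      also have "\<dots> \<le> (\<Sum>k\<in>{..<Suc n}. b0 k)" using b0 less_imp_le by (intro sum_mono2) auto
      also have "\<dots> \<le> 2 * \<sigma>0 n" using n2[OF n'(3)] unfolding \<sigma>0_def by simp
      finally have s: "s a n \<le> 2 * \<sigma>0 n" .
      have "c * t n \<le> a n * s a n" by (rule ct[OF n'(2,1)])
      also have "\<dots> \<le> b0 n * (2 * \<sigma>0 n)"
        using s spos b0[of n] by (intro mult_mono) (auto simp: b0_def add_increasing2)
      finally have "24 * t n \<le> 48 / c * (b0 n * \<sigma>0 n)" using c(1) by (simp add: field_simps)
      then show "24 * t n \<le> b n * (\<Sum>k<n. b k)" unfolding sumb \<kappa>(2)[symmetric] by (simp add: b_def power2_eq_square mult_ac)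
    qed
    show "filterlim (\<lambda>n. \<Sum>k<n. b k) at_top sequentially"
      unfolding sumb by (rule filterlim_tendsto_pos_mult_at_top[OF tendsto_const \<kappa>(1) \<sigma>0])
  qed
qed

text \<open>Provides the maximum demanded when some \<open>t n\<close> is 1. If it were not
  attained, the null sequence \<bar>Y\<bar> would stay below some \<eta> < \<mu>, and late pairs
  below (\<mu> + \<eta>)/2 since Y (L n) tends to 0; finitely many values, each below \<mu>,
  remain.\<close>

lemma sup_attained_of_far_pairs:
  fixes Y :: "nat \<Rightarrow> real"
  assumes Y: "Y \<longlonglongrightarrow> 0" and L: "filterlim L at_top sequentially"
    and even: "\<And>i. f (2 * i) = \<bar>Y i\<bar>"
    and odd: "\<And>n. f (2 * n + 1) \<le> \<bar>Y (p n)\<bar> + \<bar>Y (L n)\<bar>"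
    and bdd: "bdd_above (range f)"
  shows "\<exists>k. f k = (SUP j. f j)"
proof (rule ccontr)
  define \<mu> where "\<mu> = (SUP j. f j)"
  have le: "f k \<le> \<mu>" for k unfolding \<mu>_def by (rule cSUP_upper[OF _ bdd]) simp
  assume "\<not> ?thesis"
  then have lt: "f k < \<mu>" for k using le[of k] unfolding \<mu>_def by (metis order_le_less)
  have Ylt: "\<bar>Y i\<bar> < \<mu>" for i using lt[of "2 * i"] even by simp
  then have \<mu>: "0 < \<mu>" using abs_ge_zero by (rule le_less_trans[rotated])
  have Yabs: "(\<lambda>i. \<bar>Y i\<bar>) \<longlonglongrightarrow> 0" using Y by (rule tendsto_rabs_zero)
  have "\<forall>\<^sub>F i in sequentially. \<bar>Y i\<bar> < \<mu> / 2"
    using order_tendstoD(2)[OF Yabs, of "\<mu> / 2"] \<mu> by simp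
  then obtain N1 where N1: "\<And>i. N1 \<le> i \<Longrightarrow> \<bar>Y i\<bar> < \<mu> / 2" unfolding eventually_sequentially by blast
  define \<eta> where "\<eta> = Max (insert (\<mu> / 2) ((\<lambda>i. \<bar>Y i\<bar>) ` {..<N1}))"
  have \<eta>: "\<eta> < \<mu>" unfolding \<eta>_def using Ylt \<mu> by (subst Max_less_iff) auto
  have Y\<eta>: "\<bar>Y i\<bar> \<le> \<eta>" for i
  proof (cases "i < N1")
    case True then show ?thesis unfolding \<eta>_def by (intro Max_ge) auto
  next
    case False
    then have "\<bar>Y i\<bar> \<le> \<mu> / 2" using N1[of i] by simp
    also have "\<dots> \<le> \<eta>" unfolding \<eta>_def by (intro Max_ge) auto
    finally show ?thesis .
  qed
  have "\<forall>\<^sub>F n in sequentially. \<bar>Y (L n)\<bar> < (\<mu> - \<eta>) / 2"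
    using order_tendstoD(2)[OF filterlim_compose[OF Yabs L], of "(\<mu> - \<eta>) / 2"] \<eta> by simp
  then obtain N2 where N2: "\<And>n. N2 \<le> n \<Longrightarrow> \<bar>Y (L n)\<bar> < (\<mu> - \<eta>) / 2"
    unfolding eventually_sequentially by blast
  define \<eta>' where "\<eta>' = Max (insert ((\<mu> + \<eta>) / 2) (f ` {..2 * N2 + 1}))"
  have "\<eta>' < \<mu>" unfolding \<eta>'_def using lt \<eta> by (subst Max_less_iff) auto
  have "f k \<le> \<eta>'" for k
  proof (cases "k \<le> 2 * N2 + 1")
    case True then show ?thesis unfolding \<eta>'_def by (intro Max_ge) auto
  next
    case False
    have "f k \<le> (\<mu> + \<eta>) / 2"
    proof (cases "even k")
      case True
      then obtain i where "k = 2 * i" by blast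
      then show ?thesis using even[of i] Y\<eta>[of i] \<eta> by simp
    next
      case odd: False
      then obtain n where n: "k = 2 * n + 1" by (blast elim: oddE)
      then have "N2 \<le> n" using False by simp
      then show ?thesis using assms(4)[of n] Y\<eta>[of "p n"] N2[of n] unfolding n by (simp add: field_simps)
    qed
    also have "\<dots> \<le> \<eta>'" unfolding \<eta>'_def by (intro Max_ge) auto
    finally show ?thesis .
  qed
  then have "\<mu> \<le> \<eta>'" unfolding \<mu>_def by (intro cSUP_least) auto
  then show False using \<open>\<eta>' < \<mu>\<close> by simp
qed

theorem convergence_imp_condition_T:
  assumes t: "\<And>n. 0 \<le> t n" "\<And>n. t n \<le> 1"
    and inf: "infinite_dimensional TYPE('a::{real_inner,complete_space})"
    and conv: "remote_projections_converge t TYPE('a::{real_inner,complete_space}) TYPE(nat)"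
  shows "condition_T t"
proof (rule ccontr)
  assume "\<not> condition_T t"
  then obtain b n0 where b: "\<And>n. 0 < b n"
    "\<forall>n\<ge>n0. (\<Sum>k=n0..<n. (b k)\<^sup>2) \<le> 1 / 576"
    "\<forall>n\<ge>n0. 24 * t n \<le> b n * (\<Sum>k<n. b k)"
    "filterlim (\<lambda>n. \<Sum>k<n. b k) at_top sequentially"
    using not_condition_T_obtain[of t] t(1) by blast
  obtain w L p A B where *: "\<forall>n. balanced (w n) (L n) \<and> p n < L n \<and> 0 \<le> A n \<and> 0 \<le> B n \<and>
      (A n)\<^sup>2 + (B n)\<^sup>2 = 1 \<and> w (Suc n) = shift_mass (w n) (L n) (p n) (A n) (B n) \<and>
      t n * max_coord (w n) (L n) \<le> A n * w n (p n) - B n * w n (L n) \<and>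
      1 / 4 \<le> (\<Sum>k\<le>L n. (w n k)\<^sup>2)"
    and L: "filterlim L at_top sequentially"
    using greedy_coordinates[OF t b] by (elim exE conjE)
  have bal: "balanced (w n) (L n)" and p: "p n < L n"
    and A: "0 \<le> A n" and B: "0 \<le> B n" and AB: "(A n)\<^sup>2 + (B n)\<^sup>2 = 1"
    and w': "w (Suc n) = shift_mass (w n) (L n) (p n) (A n) (B n)"
    and weak: "t n * max_coord (w n) (L n) \<le> A n * w n (p n) - B n * w n (L n)"
    and F: "1 / 4 \<le> (\<Sum>k\<le>L n. (w n k)\<^sup>2)" for n
    using * by blast+
  have "(A n)\<^sup>2 \<le> 1\<^sup>2" "(B n)\<^sup>2 \<le> 1\<^sup>2" for n
    using AB[of n] zero_le_power2[of "A n"] zero_le_power2[of "B n"] unfolding one_power2 by linarith+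
  then have A1: "A n \<le> 1" and B1: "B n \<le> 1" for n
    by (blast intro: power2_le_imp_le zero_le_one)+
  obtain e :: "nat \<Rightarrow> 'a" where e: "\<And>i j. e i \<bullet> e j = (if i = j then 1 else 0)"
    using infinite_dimensional_orthonormal_sequence[OF inf] by blast
  define x where "x n = (\<Sum>k\<le>L n. w n k *\<^sub>R e k)" for n
  define \<phi> where "\<phi> n = A n *\<^sub>R e (p n) - B n *\<^sub>R e (L n)" for n
  \<comment> \<open>With all \<open>e i\<close> in the dictionary the supremum of the distances is attained at every point, and
    the intersection meets the closed span of \<open>e\<close> only in \<open>0\<close>.\<close>
  define \<psi> where "\<psi> k = (if even k then e (k div 2) else \<phi> (k div 2))" for k
  define C where "C k = {y. y \<bullet> \<psi> k = 0}" for k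
  have \<psi>e: "\<psi> (2 * i) = e i" and \<psi>\<phi>: "\<psi> (2 * n + 1) = \<phi> n" for i n unfolding \<psi>_def by simp_all
  have n\<psi>: "norm (\<psi> k) = 1" for k
  proof -
    have "\<phi> n \<bullet> \<phi> n = 1" for n
      using AB[of n] p[of n] unfolding \<phi>_def
      by (simp add: inner_diff_left inner_diff_right e power2_eq_square)
    then have "\<psi> k \<bullet> \<psi> k = 1" unfolding \<psi>_def by (simp add: e)
    then show ?thesis by (simp add: norm_eq_sqrt_inner)
  qed
  have wzero: "w n k = 0" if "L n < k" for n k using bal[of n] that unfolding balanced_def by blast
  have wpos: "0 \<le> w n k" for n k using bal[of n] unfolding balanced_def by blast
  have xe: "x n \<bullet> e i = w n i" for n i
  proof -
    have "x n \<bullet> e i = (\<Sum>k\<le>L n. if k = i then w n i else 0)"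
      unfolding x_def inner_sum_left by (intro sum.cong) (auto simp: e)
    then show ?thesis using wzero[of n i] by (simp add: not_le)
  qed
  have x\<phi>: "x n \<bullet> \<phi> m = A m * w n (p m) - B m * w n (L m)" for n m
    unfolding \<phi>_def by (simp add: inner_diff_right xe)
  have xx: "x n \<bullet> x n = (\<Sum>k\<le>L n. (w n k)\<^sup>2)" for n
    by (subst (2) x_def) (simp add: inner_sum_right xe power2_eq_square)
  have xK: "x n = (\<Sum>k\<le>K. w n k *\<^sub>R e k)" if "L n \<le> K" for n K
    unfolding x_def using that wzero by (intro sum.mono_neutral_left) auto
  have xstep: "x (Suc n) = x n - (x n \<bullet> \<phi> n) *\<^sub>R \<phi> n" for n
  proof -
    define K where "K = max (L n) (L (Suc n))"
    define g where "g = x n \<bullet> \<phi> n"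
    have K: "L n \<le> K" "L (Suc n) \<le> K" "p n \<le> K" unfolding K_def using p[of n] by auto
    have "w (Suc n) k *\<^sub>R e k = w n k *\<^sub>R e k - (if k = p n then (g * A n) *\<^sub>R e (p n) else 0)
        + (if k = L n then (g * B n) *\<^sub>R e (L n) else 0)" for k
      unfolding w' shift_mass_def g_def x\<phi> using p[of n]
      by (simp add: scaleR_diff_left scaleR_add_left)
    then have "x (Suc n) = (\<Sum>k\<le>K. w n k *\<^sub>R e k) - (g * A n) *\<^sub>R e (p n) + (g * B n) *\<^sub>R e (L n)"
      unfolding xK[OF K(2)] using K by (simp add: sum.distrib sum_subtractf)
    also have "\<dots> = x n - g *\<^sub>R \<phi> n"
      unfolding xK[OF K(1)] \<phi>_def by (simp add: scaleR_diff_right)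
    finally show ?thesis unfolding g_def .
  qed
  have dist: "infdist y (C k) = \<bar>y \<bullet> \<psi> k\<bar>" for y k
    unfolding C_def by (rule infdist_hyperplane[OF n\<psi>])
  have bdd: "bdd_above (range (\<lambda>k. \<bar>y \<bullet> \<psi> k\<bar>))" for y
  proof (rule bdd_aboveI2)
    show "\<bar>y \<bullet> \<psi> k\<bar> \<le> norm y" for k using Cauchy_Schwarz_ineq2[of y "\<psi> k"] n\<psi> by simp
  qed
  have attained: "\<exists>k. \<bar>y \<bullet> \<psi> k\<bar> = (SUP j. \<bar>y \<bullet> \<psi> j\<bar>)" for y
  proof (rule sup_attained_of_far_pairs[where Y = "\<lambda>i. y \<bullet> e i" and p = p, OF _ L _ _ bdd])
    show "(\<lambda>i. y \<bullet> e i) \<longlonglongrightarrow> 0" by (rule orthonormal_inner_tendsto_zero[OF e])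
    show "\<bar>y \<bullet> \<psi> (2 * i)\<bar> = \<bar>y \<bullet> e i\<bar>" for i unfolding \<psi>e ..
    show "\<bar>y \<bullet> \<psi> (2 * n + 1)\<bar> \<le> \<bar>y \<bullet> e (p n)\<bar> + \<bar>y \<bullet> e (L n)\<bar>" for n
    proof -
      have "\<bar>y \<bullet> \<phi> n\<bar> \<le> \<bar>A n * (y \<bullet> e (p n))\<bar> + \<bar>B n * (y \<bullet> e (L n))\<bar>"
        unfolding \<phi>_def inner_diff_right inner_scaleR_right by (rule abs_triangle_ineq4)
      also have "\<dots> \<le> \<bar>y \<bullet> e (p n)\<bar> + \<bar>y \<bullet> e (L n)\<bar>"
        using A[of n] B[of n] A1[of n] B1[of n]
        by (intro add_mono) (simp_all add: abs_mult mult_left_le_one_le)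
      finally show ?thesis unfolding \<psi>\<phi> .
    qed
  qed
  have sup: "(SUP j. \<bar>x n \<bullet> \<psi> j\<bar>) \<le> max_coord (w n) (L n)" for n
  proof (rule cSUP_least)
    fix k
    have M: "w n i \<le> max_coord (w n) (L n)" for i by (rule balanced_le_max_coord[OF bal])
    have "\<bar>x n \<bullet> \<phi> m\<bar> \<le> max_coord (w n) (L n)" for m
    proof -
      have "A m * w n (p m) \<le> w n (p m)" "B m * w n (L m) \<le> w n (L m)"
        using A B A1 B1 wpos by (simp_all add: mult_left_le_one_le)
      moreover have "0 \<le> A m * w n (p m)" "0 \<le> B m * w n (L m)" using A B wpos by simp_all
      ultimately show ?thesis unfolding x\<phi> using M[of "p m"] M[of "L m"] by linarith
    qed
    then show "\<bar>x n \<bullet> \<psi> k\<bar> \<le> max_coord (w n) (L n)"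
      unfolding \<psi>_def using M wpos by (simp add: xe)
  qed simp
  have 1: "remote_projections UNIV C t (x 0) x"
    unfolding remote_projections_def dist
  proof (intro conjI allI impI)
    show "\<exists>k\<in>UNIV. \<bar>y \<bullet> \<psi> k\<bar> = (SUP j. \<bar>y \<bullet> \<psi> j\<bar>)" for y using attained by simp
    \<comment> \<open>At time n the odd index 2n+1 selects the hyperplane orthogonal to
      \<open>\<phi> n\<close>.\<close>
    show "\<exists>k\<in>UNIV. t n * (SUP j. \<bar>x n \<bullet> \<psi> j\<bar>) \<le> \<bar>x n \<bullet> \<psi> k\<bar> \<and> x (Suc n) = metric_proj (C k) (x n)" for n
    proof (intro bexI conjI)
      have "t n * (SUP j. \<bar>x n \<bullet> \<psi> j\<bar>) \<le> t n * max_coord (w n) (L n)"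
        using sup t(1) by (rule mult_left_mono)
      also have "\<dots> \<le> x n \<bullet> \<phi> n" unfolding x\<phi> by (rule weak)
      finally show "t n * (SUP j. \<bar>x n \<bullet> \<psi> j\<bar>) \<le> \<bar>x n \<bullet> \<psi> (2 * n + 1)\<bar>" unfolding \<psi>\<phi> by linarith
      show "x (Suc n) = metric_proj (C (2 * n + 1)) (x n)"
        unfolding C_def metric_proj_hyperplane[OF n\<psi>] unfolding \<psi>\<phi> by (rule xstep)
    qed simp
  qed simp
  have 2: "unif_quasi_symmetric_wrt UNIV C 0"
    unfolding unif_quasi_symmetric_wrt_def unif_quasi_symmetric_def
    by (auto simp: C_def intro!: exI[of _ 1])
  have 3: "\<forall>k\<in>UNIV. closed (C k) \<and> convex (C k)"
    unfolding C_def by (simp add: closed_convex_hyperplane0)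
  have 4: "\<exists>k\<in>UNIV. \<exists>j\<in>UNIV. k \<noteq> (j::nat)" using zero_neq_one by blast
  have "\<exists>z\<in>(\<Inter>k\<in>UNIV. C k). x \<longlonglongrightarrow> z"
    using conv[unfolded remote_projections_converge_def, rule_format, OF conjI[OF 4 conjI[OF 3 conjI[OF 2 1]]]] .
  then obtain z where zC: "\<And>k. z \<in> C k" and z: "x \<longlonglongrightarrow> z" by blast
  \<comment> \<open>The limit is orthogonal to all \<open>e i\<close>, yet it is a limit of their
    combinations, hence orthogonal to itself; but |x n|^2 \<ge> 1/4.\<close>
  have "z \<bullet> e i = 0" for i using zC[of "2 * i"] unfolding C_def \<psi>e by simp
  then have zx: "z \<bullet> x n = 0" for n unfolding x_def by (simp add: inner_sum_right)
  have "(\<lambda>n. z \<bullet> x n) \<longlonglongrightarrow> z \<bullet> z" by (intro tendsto_inner tendsto_const z)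
  then have "z \<bullet> z = 0" unfolding zx by (simp add: LIMSEQ_const_iff)
  then have "z = 0" by simp
  have "(\<lambda>n. x n \<bullet> x n) \<longlonglongrightarrow> z \<bullet> z" by (intro tendsto_inner z)
  then have "1 / 4 \<le> z \<bullet> z"
    by (rule LIMSEQ_le_const) (use F xx in auto)
  then show False using \<open>z = 0\<close> by simp
qed

text \<open>A formula cannot quantify over all Hilbert spaces as types, so (ii) is taken per type:
  sufficiency for arbitrary space and index types, necessity already from one infinite-dimensional
  space and families indexed by \<open>nat\<close>.\<close>

theorem theorem1:
  fixes t :: "nat \<Rightarrow> real"
  assumes "\<And>n. 0 \<le> t n \<and> t n \<le> 1"
  shows "(condition_T t \<longrightarrow> remote_projections_converge t TYPE('a::{real_inner,complete_space}) TYPE('i))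
       \<and> (infinite_dimensional TYPE('a) \<longrightarrow>
            remote_projections_converge t TYPE('a) TYPE(nat) \<longrightarrow> condition_T t)"
proof (intro conjI impI)
  assume T: "condition_T t"
  show "remote_projections_converge t TYPE('a) TYPE('i)"
    unfolding remote_projections_converge_def
  proof (intro allI impI, elim conjE)
    fix \<Omega> :: "'i set" and C :: "'i \<Rightarrow> 'a set" and a x0 x
    assume "\<forall>\<alpha>\<in>\<Omega>. closed (C \<alpha>) \<and> convex (C \<alpha>)" "unif_quasi_symmetric_wrt \<Omega> C a"
      "remote_projections \<Omega> C t x0 x"
    then show "\<exists>z \<in> (\<Inter>\<alpha>\<in>\<Omega>. C \<alpha>). x \<longlonglongrightarrow> z"
      using assms T by (intro condition_T_imp_convergence[of t]) auto
  qed
next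
  assume "infinite_dimensional TYPE('a)" "remote_projections_converge t TYPE('a) TYPE(nat)"
  then show "condition_T t" using assms by (intro convergence_imp_condition_T) auto
qed

end
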